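(* Let $\alpha$ be an $E_0$-semigroup on a $\mathrm{II}_1$ factor $\mathrm{M}$. The gauge index $\dim G(\alpha)$ is zero if and only if the gauge group is trivial, i.e. every gauge cocycle of $\alpha$ is of the form $U_t=e^{i\theta t}1$ ($t\ge 0$) for some $\theta\in\mathbb{R}$, so that $G(\alpha)\cong(\mathbb{R},+)$.
   Context: An $E_0$-semigroup on a von Neumann algebra $\mathrm{M}$ is a semigroup $(\alpha_t)_{t\ge 0}$ of normal unital $*$-endomorphisms of $\mathrm{M}$ with $\alpha_0=\mathrm{id}$, $\alpha_t(\mathrm{M})\ne \mathrm{M}$ for all $t>0$, and $t\mapsto\rho(\alpha_t(x))$ continuous for all $x\in\mathrm{M}$, $\rho\in\mathrm{M}_*$. A cocycle for $\alpha$ is a strongly continuous family of unitaries $(U_t)_{t\ge0}$ in $\mathrm{M}$ with $U_s\alpha_s(U_t)=U_{s+t}$ for all $s,t\ge 0$. Let $\tau$ be the trace of $\mathrm{M}$. A gauge cocycle for $\alpha$ is a cocycle $U$ with $U_t\in\mathrm{M}\cap\alpha_t(\mathrm{M})'$ for all $t\ge0$; the gauge cocycles form a group $G(\alpha)$ (the gauge group) under $(UV)_t=U_tV_t$. For $U,V\in G(\alpha)$ there is a unique $c_*(U,V)\in\mathbb{C}$ with $\tau(U_t^*V_t)=e^{c_*(U,V)t}$ for all $t\ge0$. The form $\langle f,g\rangle=\sum_{U,V}c_*(U,V)\overline{f(U)}g(V)$ is positive semidefinite on the space of finitely supported functions $f:G(\alpha)\to\mathbb{C}$ with $\sum_Uf(U)=0$;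 $H(G(\alpha))$ is the Hilbert space obtained by quotienting by null vectors and completing. The gauge index is $\dim G(\alpha):=\dim H(G(\alpha))$. *)

theory Defs
  imports "HOL-Analysis.Analysis" "HOL-Algebra.Group"
begin

unbundle cardinal_syntax

section \<open>Complex Hilbert spaces and bounded operators\<close>

class chilbert_space = banach +
  fixes scaleC :: "complex \<Rightarrow> 'a \<Rightarrow> 'a" (infixr \<open>*\<^sub>C\<close> 75)
    and cinner :: "'a \<Rightarrow> 'a \<Rightarrow> complex"
  assumes scaleC_add_right: "c *\<^sub>C (x + y) = c *\<^sub>C x + c *\<^sub>C y"
    and scaleC_add_left: "(c + d) *\<^sub>C x = c *\<^sub>C x + d *\<^sub>C x"
    and scaleC_scaleC: "c *\<^sub>C d *\<^sub>C x = (c * d) *\<^sub>C x"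
    and scaleR_scaleC: "r *\<^sub>R x = complex_of_real r *\<^sub>C x"
    and cinner_commute: "cinner x y = cnj (cinner y x)"
    and cinner_add_right: "cinner x (y + z) = cinner x y + cinner x z"
    and cinner_scaleC_right: "cinner x (c *\<^sub>C y) = c * cinner x y"
    and cinner_self: "cinner x x = complex_of_real ((norm x)\<^sup>2)"

lemma norm_scaleC: "norm (c *\<^sub>C x) = cmod c * norm (x::'a::chilbert_space)"
proof -
  have "cinner (c *\<^sub>C x) (c *\<^sub>C x) = c * cnj (cinner x (c *\<^sub>C x))"
    by (metis cinner_commute cinner_scaleC_right)
  also have "\<dots> = (c * cnj c) * cnj (cinner x x)"
    by (simp add: cinner_scaleC_right)
  also have "\<dots> = complex_of_real ((cmod c * norm x)\<^sup>2)"
    by (simp add: cinner_self complex_norm_square power_mult_distrib del: of_real_power)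
  finally have "(norm (c *\<^sub>C x))\<^sup>2 = (cmod c * norm x)\<^sup>2"
    unfolding cinner_self of_real_eq_iff .
  then show ?thesis
    by (simp add: power2_eq_iff_nonneg)
qed

lemma bounded_linear_scaleC: "bounded_linear (\<lambda>x::'a::chilbert_space. c *\<^sub>C x)"
proof (rule bounded_linear_intro[where K = "cmod c"])
  fix r and x :: 'a
  show "c *\<^sub>C r *\<^sub>R x = r *\<^sub>R c *\<^sub>C x"
    by (simp add: scaleR_scaleC scaleC_scaleC mult.commute)
qed (simp_all add: scaleC_add_right norm_scaleC mult.commute)

type_synonym 'h op = "'h \<Rightarrow>\<^sub>L 'h"

text \<open>The type \<^typ>\<open>'h op\<close> consists of the bounded real-linear maps; the algebra of bounded
  operators is cut out by complex linearity.\<close>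

definition bops :: "'h::chilbert_space op set"
  where "bops = {T. \<forall>c x. blinfun_apply T (c *\<^sub>C x) = c *\<^sub>C blinfun_apply T x}"

lift_definition op_scale :: "complex \<Rightarrow> 'h::chilbert_space op \<Rightarrow> 'h op" (infixr \<open>*\<^sub>O\<close> 75)
  is "\<lambda>c T x. c *\<^sub>C T x"
  by (rule bounded_linear_compose[OF bounded_linear_scaleC])

definition op_adj :: "'h::chilbert_space op \<Rightarrow> 'h op"
  where "op_adj T = (THE S. \<forall>x y. cinner (blinfun_apply S x) y = cinner x (blinfun_apply T y))"

definition unitary :: "'h::chilbert_space op \<Rightarrow> bool"
  where "unitary U \<longleftrightarrow>
    U \<in> bops \<and> op_adj U o\<^sub>L U = id_blinfun \<and> U o\<^sub>L op_adj U = id_blinfun"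

section \<open>Von Neumann algebras\<close>

definition commutant :: "'h::chilbert_space op set \<Rightarrow> 'h op set"
  where "commutant S = {T \<in> bops. \<forall>A\<in>S. T o\<^sub>L A = A o\<^sub>L T}"

definition von_neumann_algebra :: "'h::chilbert_space op set \<Rightarrow> bool"
  where "von_neumann_algebra M \<longleftrightarrow>
    M \<subseteq> bops \<and> (\<forall>T\<in>M. op_adj T \<in> M) \<and> commutant (commutant M) = M"

definition factor :: "'h::chilbert_space op set \<Rightarrow> bool"
  where "factor M \<longleftrightarrow>
    von_neumann_algebra M \<and> M \<inter> commutant M = {c *\<^sub>O id_blinfun | c. True}"

text \<open>The normal (ultraweakly continuous) functionals on \<open>M\<close>. Only the values on \<open>M\<close> matter.\<close>

definition predual :: "'h::chilbert_space op set \<Rightarrow> ('h op \<Rightarrow> complex) set"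
  where "predual M = {\<rho>. \<exists>\<xi> \<eta> :: nat \<Rightarrow> 'h.
    summable (\<lambda>n. (norm (\<xi> n))\<^sup>2) \<and> summable (\<lambda>n. (norm (\<eta> n))\<^sup>2) \<and>
    (\<forall>x\<in>M. \<rho> x = (\<Sum>n. cinner (\<xi> n) (blinfun_apply x (\<eta> n))))}"

text \<open>Linearity on \<open>M\<close> is part of membership in the predual.\<close>

definition faithful_normal_tracial_state ::
    "'h::chilbert_space op set \<Rightarrow> ('h op \<Rightarrow> complex) \<Rightarrow> bool"
  where "faithful_normal_tracial_state M \<tau> \<longleftrightarrow>
    \<tau> \<in> predual M \<and> \<tau> id_blinfun = 1 \<and>
    (\<forall>x\<in>M. \<tau> (op_adj x o\<^sub>L x) \<in> \<real>\<^sub>\<ge>\<^sub>0) \<and>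
    (\<forall>x\<in>M. \<tau> (op_adj x o\<^sub>L x) = 0 \<longrightarrow> x = 0) \<and>
    (\<forall>x\<in>M. \<forall>y\<in>M. \<tau> (x o\<^sub>L y) = \<tau> (y o\<^sub>L x))"

text \<open>Infinite-dimensionality is expressed with the real span, which gives the same notion as
  the complex span.\<close>

definition II1_factor :: "'h::chilbert_space op set \<Rightarrow> bool"
  where "II1_factor M \<longleftrightarrow>
    factor M \<and> \<not> (\<exists>B. finite B \<and> M \<subseteq> span B) \<and> (\<exists>\<tau>. faithful_normal_tracial_state M \<tau>)"

definition normal_unital_star_endomorphism ::
    "'h::chilbert_space op set \<Rightarrow> ('h op \<Rightarrow> 'h op) \<Rightarrow> bool"
  where "normal_unital_star_endomorphism M \<phi> \<longleftrightarrow>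
    \<phi> \<in> M \<rightarrow> M \<and>
    (\<forall>x\<in>M. \<forall>y\<in>M. \<phi> (x + y) = \<phi> x + \<phi> y) \<and>
    (\<forall>c. \<forall>x\<in>M. \<phi> (c *\<^sub>O x) = c *\<^sub>O \<phi> x) \<and>
    (\<forall>x\<in>M. \<forall>y\<in>M. \<phi> (x o\<^sub>L y) = \<phi> x o\<^sub>L \<phi> y) \<and>
    (\<forall>x\<in>M. \<phi> (op_adj x) = op_adj (\<phi> x)) \<and>
    \<phi> id_blinfun = id_blinfun \<and>
    (\<forall>\<rho>\<in>predual M. \<rho> \<circ> \<phi> \<in> predual M)"

section \<open>E0-semigroups and their gauge cocycles\<close>

definition E0_semigroup :: "'h::chilbert_space op set \<Rightarrow> (real \<Rightarrow> 'h op \<Rightarrow> 'h op) \<Rightarrow> bool"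
  where "E0_semigroup M \<alpha> \<longleftrightarrow>
    (\<forall>t\<ge>0. normal_unital_star_endomorphism M (\<alpha> t)) \<and>
    (\<forall>x\<in>M. \<alpha> 0 x = x) \<and>
    (\<forall>s\<ge>0. \<forall>t\<ge>0. \<forall>x\<in>M. \<alpha> (s + t) x = \<alpha> s (\<alpha> t x)) \<and>
    (\<forall>t>0. \<alpha> t ` M \<noteq> M) \<and>
    (\<forall>x\<in>M. \<forall>\<rho>\<in>predual M. continuous_on {0..} (\<lambda>t. \<rho> (\<alpha> t x)))"

text \<open>Families indexed by \<open>t \<ge> 0\<close> are encoded as extensional functions on \<open>{0..}\<close>, so that
  equality of cocycles is equality at all \<open>t \<ge> 0\<close>.\<close>

definition cocycle ::
    "'h::chilbert_space op set \<Rightarrow> (real \<Rightarrow> 'h op \<Rightarrow> 'h op) \<Rightarrow> (real \<Rightarrow> 'h op) \<Rightarrow> bool"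
  where "cocycle M \<alpha> U \<longleftrightarrow>
    U \<in> {0..} \<rightarrow>\<^sub>E {V \<in> M. unitary V} \<and>
    (\<forall>x. continuous_on {0..} (\<lambda>t. blinfun_apply (U t) x)) \<and>
    (\<forall>s\<ge>0. \<forall>t\<ge>0. U s o\<^sub>L \<alpha> s (U t) = U (s + t))"

definition gauge_cocycle ::
    "'h::chilbert_space op set \<Rightarrow> (real \<Rightarrow> 'h op \<Rightarrow> 'h op) \<Rightarrow> (real \<Rightarrow> 'h op) \<Rightarrow> bool"
  where "gauge_cocycle M \<alpha> U \<longleftrightarrow>
    cocycle M \<alpha> U \<and> (\<forall>t\<ge>0. U t \<in> M \<inter> commutant (\<alpha> t ` M))"

definition gauge_group ::
    "'h::chilbert_space op set \<Rightarrow> (real \<Rightarrow> 'h op \<Rightarrow> 'h op) \<Rightarrow> (real \<Rightarrow> 'h op) monoid"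
  where "gauge_group M \<alpha> =
    \<lparr>carrier = {U. gauge_cocycle M \<alpha> U},
     mult = (\<lambda>U V. \<lambda>t\<in>{0..}. U t o\<^sub>L V t),
     one = (\<lambda>t\<in>{0..}. id_blinfun)\<rparr>"

definition gauge_group_trivial ::
    "'h::chilbert_space op set \<Rightarrow> (real \<Rightarrow> 'h op \<Rightarrow> 'h op) \<Rightarrow> bool"
  where "gauge_group_trivial M \<alpha> \<longleftrightarrow>
    (\<forall>U\<in>carrier (gauge_group M \<alpha>). \<exists>\<theta>::real. \<forall>t\<ge>0.
       U t = exp (\<i> * complex_of_real (\<theta> * t)) *\<^sub>O id_blinfun)"

section \<open>Quotient by null vectors, completion, and dimension\<close>

text \<open>A complex vector space with a sesquilinear form, given by its operations; the form is
  conjugate-linear in the first argument.\<close>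

record 'v form_space =
  vecs :: "'v set"
  vadd :: "'v \<Rightarrow> 'v \<Rightarrow> 'v"
  vscale :: "complex \<Rightarrow> 'v \<Rightarrow> 'v"
  vform :: "'v \<Rightarrow> 'v \<Rightarrow> complex"

definition vdiff :: "'v form_space \<Rightarrow> 'v \<Rightarrow> 'v \<Rightarrow> 'v"
  where "vdiff X x y = vadd X x (vscale X (-1) y)"

definition vdist :: "'v form_space \<Rightarrow> 'v \<Rightarrow> 'v \<Rightarrow> real"
  where "vdist X x y = sqrt (Re (vform X (vdiff X x y) (vdiff X x y)))"

definition null_rel :: "'v form_space \<Rightarrow> ('v \<times> 'v) set"
  where "null_rel X =
    {(x, y). x \<in> vecs X \<and> y \<in> vecs X \<and> vform X (vdiff X x y) (vdiff X x y) = 0}"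

text \<open>The quotient by the null vectors; the operations are computed on arbitrary
  representatives.\<close>

definition null_quotient :: "'v form_space \<Rightarrow> 'v set form_space"
  where "null_quotient X =
    (let rep = (\<lambda>A. SOME x. x \<in> A); cls = (\<lambda>x. null_rel X `` {x}) in
     \<lparr>vecs = vecs X // null_rel X,
      vadd = (\<lambda>A B. cls (vadd X (rep A) (rep B))),
      vscale = (\<lambda>c A. cls (vscale X c (rep A))),
      vform = (\<lambda>A B. vform X (rep A) (rep B))\<rparr>)"

definition cauchy_space :: "'v form_space \<Rightarrow> (nat \<Rightarrow> 'v) form_space"
  where "cauchy_space X =
    \<lparr>vecs = {s. range s \<subseteq> vecs X \<and>
        (\<forall>e>0. \<exists>N. \<forall>m\<ge>N. \<forall>n\<ge>N. vdist X (s m) (s n) < e)},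
     vadd = (\<lambda>s t n. vadd X (s n) (t n)),
     vscale = (\<lambda>c s n. vscale X c (s n)),
     vform = (\<lambda>s t. lim (\<lambda>n. vform X (s n) (t n)))\<rparr>"

text \<open>Cauchy sequences modulo null sequences: the latter are the null vectors of
  \<^const>\<open>cauchy_space\<close>.\<close>

definition completion :: "'v form_space \<Rightarrow> (nat \<Rightarrow> 'v) set form_space"
  where "completion X = null_quotient (cauchy_space X)"

definition orthonormal :: "'v form_space \<Rightarrow> 'v set \<Rightarrow> bool"
  where "orthonormal X B \<longleftrightarrow>
    B \<subseteq> vecs X \<and> (\<forall>a\<in>B. \<forall>b\<in>B. vform X a b = (if a = b then 1 else 0))"

text \<open>An orthonormal basis is a maximal orthonormal set.\<close>

definition orthonormal_basis :: "'v form_space \<Rightarrow> 'v set \<Rightarrow> bool"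
  where "orthonormal_basis X B \<longleftrightarrow>
    orthonormal X B \<and> (\<forall>C. orthonormal X C \<and> B \<subseteq> C \<longrightarrow> C = B)"

text \<open>The Hilbert space dimension, as a cardinal.\<close>

definition hilbert_dim :: "'v form_space \<Rightarrow> 'v rel"
  where "hilbert_dim X = |SOME B. orthonormal_basis X B|"

section \<open>The gauge index\<close>

definition c_star ::
    "('h::chilbert_space op \<Rightarrow> complex) \<Rightarrow> (real \<Rightarrow> 'h op) \<Rightarrow> (real \<Rightarrow> 'h op) \<Rightarrow> complex"
  where "c_star \<tau> U V =
    (THE c. \<forall>t\<ge>0. \<tau> (op_adj (U t) o\<^sub>L V t) = exp (c * complex_of_real t))"

definition gauge_form_space ::
    "'h::chilbert_space op set \<Rightarrow> ('h op \<Rightarrow> complex) \<Rightarrow> (real \<Rightarrow> 'h op \<Rightarrow> 'h op) \<Rightarrow>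
      ((real \<Rightarrow> 'h op) \<Rightarrow> complex) form_space"
  where "gauge_form_space M \<tau> \<alpha> =
    \<lparr>vecs = {f. finite {U. f U \<noteq> 0} \<and> {U. f U \<noteq> 0} \<subseteq> carrier (gauge_group M \<alpha>) \<and>
        (\<Sum>U | f U \<noteq> 0. f U) = 0},
     vadd = (\<lambda>f g U. f U + g U),
     vscale = (\<lambda>c f U. c * f U),
     vform = (\<lambda>f g. \<Sum>U | f U \<noteq> 0. \<Sum>V | g V \<noteq> 0. c_star \<tau> U V * cnj (f U) * g V)\<rparr>"

definition gauge_hilbert_space ::
    "'h::chilbert_space op set \<Rightarrow> ('h op \<Rightarrow> complex) \<Rightarrow> (real \<Rightarrow> 'h op \<Rightarrow> 'h op) \<Rightarrow>
      (nat \<Rightarrow> ((real \<Rightarrow> 'h op) \<Rightarrow> complex) set) set form_space"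
  where "gauge_hilbert_space M \<tau> \<alpha> = completion (null_quotient (gauge_form_space M \<tau> \<alpha>))"

definition gauge_index ::
    "'h::chilbert_space op set \<Rightarrow> ('h op \<Rightarrow> complex) \<Rightarrow> (real \<Rightarrow> 'h op \<Rightarrow> 'h op) \<Rightarrow>
      (nat \<Rightarrow> ((real \<Rightarrow> 'h op) \<Rightarrow> complex) set) set rel"
  where "gauge_index M \<tau> \<alpha> = hilbert_dim (gauge_hilbert_space M \<tau> \<alpha>)"

end

(* Every normal tracial functional on a II_1 factor M is a multiple of the trace. Applied to
   y |-> tau(x alpha_s(y)) with x in the relative commutant of alpha_s(M), this gives
   tau(x alpha_s(y)) = tau(x) tau(y), so for gauge cocycles U, V the continuous function
   t |-> tau(U_t* V_t) is multiplicative, hence of the form exp(c t). The form defining the gauge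
   index is the derivative at 0 of Gram forms, hence positive semidefinite, and its Hilbert space
   vanishes iff the form itself does. On scalar cocycles c(U,V) is a difference of two
   one-variable functions, so the form vanishes on functions summing to zero. Conversely, if the form
   vanishes at delta_U - delta_1, then |tau(U_t)| = 1, and the equality case of the
   Cauchy-Schwarz inequality makes U_t a scalar. *)

theory Submission
  imports Defs
begin

section \<open>Positive semidefinite forms, quotients and completions\<close>

text \<open>Two obstacles shape the proof. The classical route to uniqueness of the trace goes
  through comparison of projections and hence spectral theory. Here a 2-norm is minimized over a
  weakly compact convex set, so the analysis reduces to the Riesz representation, Tychonoff's
  theorem and the parallelogram law. Unitaries come from the Cayley transform, with the inverse in
  it given by a Neumann series. The other obstacle is that the quotient and the completion are raw
  operations on records, computed on chosen representatives. They are controlled through the values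
  of the form alone, and dimension zero is translated into the absence of unit vectors: a unit
  vector survives both constructions, and so does a form that vanishes on the diagonal.\<close>

lemma psd_quadratic:
  fixes a b b' d :: complex
  assumes "\<And>c. a + c * b + cnj c * b' + c * cnj c * d \<in> \<real>\<^sub>\<ge>\<^sub>0"
    and d: "d \<in> \<real>\<^sub>\<ge>\<^sub>0"
  shows "b' = cnj b" and "(cmod b)\<^sup>2 \<le> Re a * Re d"
proof -
  have Im0: "Im (a + c * b + cnj c * b' + c * cnj c * d) = 0" for c
    using assms(1)[of c] by (auto simp: complex_nonneg_Reals_iff)
  have "Im a = 0" "Im d = 0" "Re d \<ge> 0"
    using Im0[of 0] d by (auto simp: complex_nonneg_Reals_iff)
  \<comment> \<open>The parameter 0 has made \<open>a\<close> real. The parameter 1 now gives Im b +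
    Im b' = 0, and the parameter i gives Re b = Re b'.\<close>
  then show b': "b' = cnj b"
    using Im0[of 1] Im0[of \<i>] by (auto simp: complex_eq_iff)
  have ge0: "Re a + 2 * Re (c * b) + (cmod c)\<^sup>2 * Re d \<ge> 0" for c
  proof -
    have "Re (a + c * b + cnj c * b' + c * cnj c * d) \<ge> 0"
      using assms(1)[of c] by (auto simp: complex_nonneg_Reals_iff)
    then show ?thesis
      by (simp add: b' complex_norm_square[symmetric] flip: of_real_power) (simp add: cmod_def power2_eq_square algebra_simps)
  qed
  \<comment> \<open>Here \<open>c\<close> runs through real multiples of -cnj b, the direction in
    which Re (c * b) decreases fastest; a real quadratic in \<open>s\<close> remains.\<close>
  have key: "Re a - 2 * s * (cmod b)\<^sup>2 + s\<^sup>2 * (cmod b)\<^sup>2 * Re d \<ge> 0" for s :: real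
  proof -
    have "Re (- of_real s * cnj b * b) = - s * (cmod b)\<^sup>2"
      by (simp add: cmod_power2) (simp add: power2_eq_square algebra_simps)
    then show ?thesis
      using ge0[of "- of_real s * cnj b"] by (simp add: norm_mult power_mult_distrib)
  qed
  show "(cmod b)\<^sup>2 \<le> Re a * Re d"
  proof (cases "Re d = 0")
    case True
    have "b = 0"
    proof (rule ccontr)
      assume "b \<noteq> 0"
      \<comment> \<open>For Re d = 0 the quadratic is affine in \<open>s\<close>; this
        \<open>s\<close> gives it the value -1.\<close>
      then show False
        using key[of "(Re a + 1) / (2 * (cmod b)\<^sup>2)"] True by (simp add: field_simps)
    qed
    then show ?thesis using True by simp
  next
    case False
    then have "Re d > 0" using \<open>Re d \<ge> 0\<close> by simp
    \<comment> \<open>The minimum of the quadratic is at s = 1 / Re d.\<close>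
    then show ?thesis
      using key[of "1 / Re d"] by (simp add: field_simps power2_eq_square)
  qed
qed

text \<open>Only closure of the carrier and values of the form are constrained, and vectors are
  compared through their pairings. This weak interface is easy to verify for classes with chosen
  representatives and for sequences with pointwise operations. Hermitian symmetry is derived from
  nonnegativity on the diagonal.\<close>

locale psd_space =
  fixes X :: "'v form_space"
  assumes add_closed: "x \<in> vecs X \<Longrightarrow> y \<in> vecs X \<Longrightarrow> vadd X x y \<in> vecs X"
    and scale_closed: "x \<in> vecs X \<Longrightarrow> vscale X c x \<in> vecs X"
    and form_add_left: "x \<in> vecs X \<Longrightarrow> y \<in> vecs X \<Longrightarrow> z \<in> vecs X \<Longrightarrow>
      vform X (vadd X x y) z = vform X x z + vform X y z"
    and form_add_right: "x \<in> vecs X \<Longrightarrow> y \<in> vecs X \<Longrightarrow> z \<in> vecs X \<Longrightarrow>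
      vform X z (vadd X x y) = vform X z x + vform X z y"
    and form_scale_left: "x \<in> vecs X \<Longrightarrow> z \<in> vecs X \<Longrightarrow>
      vform X (vscale X c x) z = cnj c * vform X x z"
    and form_scale_right: "x \<in> vecs X \<Longrightarrow> z \<in> vecs X \<Longrightarrow>
      vform X z (vscale X c x) = c * vform X z x"
    and form_nonneg: "x \<in> vecs X \<Longrightarrow> vform X x x \<in> \<real>\<^sub>\<ge>\<^sub>0"
begin

lemmas form_simps = add_closed scale_closed form_add_left form_add_right
  form_scale_left form_scale_right

definition vnorm :: "'v \<Rightarrow> real"
  where "vnorm x = sqrt (Re (vform X x x))"

lemma diff_closed: "x \<in> vecs X \<Longrightarrow> y \<in> vecs X \<Longrightarrow> vdiff X x y \<in> vecs X"
  by (simp add: vdiff_def form_simps)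

lemma form_diff_left: "x \<in> vecs X \<Longrightarrow> y \<in> vecs X \<Longrightarrow> z \<in> vecs X \<Longrightarrow>
    vform X (vdiff X x y) z = vform X x z - vform X y z"
  by (simp add: vdiff_def form_simps)

lemma form_diff_right: "x \<in> vecs X \<Longrightarrow> y \<in> vecs X \<Longrightarrow> z \<in> vecs X \<Longrightarrow>
    vform X z (vdiff X x y) = vform X z x - vform X z y"
  by (simp add: vdiff_def form_simps)

lemma form_self: "x \<in> vecs X \<Longrightarrow> vform X x x = complex_of_real ((vnorm x)\<^sup>2)"
  using form_nonneg[of x] by (auto simp: vnorm_def complex_nonneg_Reals_iff complex_eq_iff)

lemma vnorm_nonneg: "x \<in> vecs X \<Longrightarrow> vnorm x \<ge> 0"
  using form_nonneg[of x] by (auto simp: vnorm_def complex_nonneg_Reals_iff)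

lemma form_quadratic:
  assumes "x \<in> vecs X" "y \<in> vecs X"
  shows "vform X x x + c * vform X x y + cnj c * vform X y x + c * cnj c * vform X y y \<in> \<real>\<^sub>\<ge>\<^sub>0"
  using form_nonneg[of "vadd X x (vscale X c y)"] assms
  by (simp add: form_simps algebra_simps)

lemma form_commute: "x \<in> vecs X \<Longrightarrow> y \<in> vecs X \<Longrightarrow> vform X y x = cnj (vform X x y)"
  by (rule psd_quadratic(1)[OF form_quadratic form_nonneg])

lemma Cauchy_Schwarz:
  assumes "x \<in> vecs X" "y \<in> vecs X"
  shows "cmod (vform X x y) \<le> vnorm x * vnorm y"
proof -
  have "(cmod (vform X x y))\<^sup>2 \<le> Re (vform X x x) * Re (vform X y y)"
    by (rule psd_quadratic(2)[OF form_quadratic form_nonneg]) (use assms in auto)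
  then have "(cmod (vform X x y))\<^sup>2 \<le> (vnorm x * vnorm y)\<^sup>2"
    using assms by (simp add: form_self power_mult_distrib)
  then show ?thesis
    using assms by (simp add: power2_le_iff_abs_le vnorm_nonneg)
qed

lemma vnorm_triangle:
  assumes "x \<in> vecs X" "y \<in> vecs X"
  shows "vnorm (vadd X x y) \<le> vnorm x + vnorm y"
proof -
  have "vform X (vadd X x y) (vadd X x y) = vform X x x + vform X x y + vform X y x + vform X y y"
    using assms by (simp add: form_simps)
  then have "(vnorm (vadd X x y))\<^sup>2 = (vnorm x)\<^sup>2 + 2 * Re (vform X x y) + (vnorm y)\<^sup>2"
    using assms form_commute[of x y] by (simp add: form_self add_closed complex_eq_iff)
  also have "\<dots> \<le> (vnorm x + vnorm y)\<^sup>2"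
    using Cauchy_Schwarz[OF assms] complex_Re_le_cmod[of "vform X x y"]
    by (simp add: power2_eq_square algebra_simps)
  finally show ?thesis
    using assms by (simp add: power2_le_iff_abs_le vnorm_nonneg add_closed)
qed

lemma parallelogram:
  assumes "x \<in> vecs X" "y \<in> vecs X"
  shows "(vnorm (vdiff X x y))\<^sup>2 + (vnorm (vadd X x y))\<^sup>2 = 2 * (vnorm x)\<^sup>2 + 2 * (vnorm y)\<^sup>2"
proof -
  have "complex_of_real ((vnorm (vdiff X x y))\<^sup>2 + (vnorm (vadd X x y))\<^sup>2)
      = complex_of_real (2 * (vnorm x)\<^sup>2 + 2 * (vnorm y)\<^sup>2)"
    unfolding of_real_add of_real_mult form_self[OF assms(1), symmetric]
      form_self[OF assms(2), symmetric] form_self[OF add_closed[OF assms], symmetric]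
      form_self[OF diff_closed[OF assms], symmetric]
    using assms by (simp add: form_simps diff_closed form_diff_left form_diff_right)
  then show ?thesis unfolding of_real_eq_iff .
qed

lemma vnorm_scale:
  assumes "x \<in> vecs X" shows "vnorm (vscale X c x) = cmod c * vnorm x"
proof -
  have "vform X (vscale X c x) (vscale X c x) = cnj c * c * complex_of_real ((vnorm x)\<^sup>2)"
    unfolding form_self[OF assms, symmetric] using assms by (simp add: form_simps)
  also have "\<dots> = complex_of_real ((cmod c * vnorm x)\<^sup>2)"
    by (simp add: power_mult_distrib complex_norm_square del: of_real_power)
  finally show ?thesis
    using vnorm_nonneg[OF assms] by (simp add: vnorm_def abs_mult del: of_real_power)
qed

lemma vdist_eq: "vdist X x y = vnorm (vdiff X x y)"
  by (simp add: vdist_def vnorm_def)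

lemma vnorm_diff_self: "x \<in> vecs X \<Longrightarrow> vnorm (vdiff X x x) = 0"
  by (simp add: vnorm_def diff_closed form_diff_left)

lemma null_relI: "x \<in> vecs X \<Longrightarrow> y \<in> vecs X \<Longrightarrow> vnorm (vdiff X x y) = 0 \<Longrightarrow> (x, y) \<in> null_rel X"
  by (simp add: null_rel_def form_self diff_closed)

text \<open>By Cauchy-Schwarz a vector of norm zero pairs to zero with every vector, so the form is
  independent of representatives.\<close>

lemma null_relD:
  assumes "(x, y) \<in> null_rel X" and z: "z \<in> vecs X"
  shows "vform X y z = vform X x z" "vform X z y = vform X z x"
proof -
  have xy: "x \<in> vecs X" "y \<in> vecs X" "vnorm (vdiff X x y) = 0"
    using assms(1) by (auto simp: null_rel_def vnorm_def)
  have "vform X (vdiff X x y) z = 0" "vform X z (vdiff X x y) = 0"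
    using Cauchy_Schwarz[of "vdiff X x y" z] Cauchy_Schwarz[of z "vdiff X x y"] xy z
    by (simp_all add: diff_closed)
  then show "vform X y z = vform X x z" "vform X z y = vform X z x"
    using xy z by (simp_all add: form_diff_left form_diff_right)
qed

lemma rep_in_vecs:
  assumes "A \<in> vecs X // null_rel X"
  shows "(SOME x. x \<in> A) \<in> vecs X"
proof -
  obtain x where "x \<in> vecs X" "A = null_rel X `` {x}"
    using assms by (auto elim: quotientE)
  then have "x \<in> A" "A \<subseteq> vecs X"
    by (auto intro!: null_relI simp: vnorm_diff_self) (auto simp: null_rel_def)
  then show ?thesis by (metis someI subsetD)
qed

text \<open>As rewrite rules these reduce every computation in the quotient to one in
  \<open>X\<close>, whatever representative \<open>SOME\<close> picks.\<close>

lemma form_rep: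
  assumes x: "x \<in> vecs X" and z: "z \<in> vecs X"
  shows "vform X (SOME y. y \<in> null_rel X `` {x}) z = vform X x z"
    and "vform X z (SOME y. y \<in> null_rel X `` {x}) = vform X z x"
proof -
  have "x \<in> null_rel X `` {x}"
    using x by (auto intro!: null_relI simp: vnorm_diff_self)
  then have "(x, SOME y. y \<in> null_rel X `` {x}) \<in> null_rel X"
    by (metis Image_singleton_iff someI)
  then show "vform X (SOME y. y \<in> null_rel X `` {x}) z = vform X x z"
    and "vform X z (SOME y. y \<in> null_rel X `` {x}) = vform X z x"
    using null_relD z by blast+
qed

lemma cls_in_quotient: "x \<in> vecs X \<Longrightarrow> null_rel X `` {x} \<in> vecs X // null_rel X"
  by (rule quotientI)

lemma psd_null_quotient: "psd_space (null_quotient X)"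
  \<comment> \<open>\<open>Image_singleton_iff\<close> would unfold membership in a class and
    destroy the pattern that \<open>form_rep\<close> matches.\<close>
  by unfold_locales
    (auto simp: null_quotient_def Let_def form_rep rep_in_vecs cls_in_quotient form_simps
      simp del: Image_singleton_iff intro: form_nonneg)

lemma unit_vector_null_quotient:
  assumes x: "x \<in> vecs X" "vform X x x = 1"
  shows "\<exists>A\<in>vecs (null_quotient X). vform (null_quotient X) A A = 1"
  using assms
  by (intro bexI[of _ "null_rel X `` {x}"])
    (simp_all add: null_quotient_def Let_def form_rep rep_in_vecs cls_in_quotient
      del: Image_singleton_iff)

section \<open>The space of Cauchy sequences\<close>

lemma cauchy_spaceD:
  assumes "s \<in> vecs (cauchy_space X)" "e > 0"
  shows "\<exists>N. \<forall>m\<ge>N. \<forall>n\<ge>N. vdist X (s m) (s n) < e"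
  using assms by (simp add: cauchy_space_def)

lemma cauchy_vnorm:
  assumes s: "s \<in> vecs (cauchy_space X)"
  shows "Cauchy (\<lambda>n. vnorm (s n))"
proof (rule metric_CauchyI)
  fix e :: real assume "e > 0"
  have sX: "s n \<in> vecs X" for n
    using s by (auto simp: cauchy_space_def)
  obtain N where N: "\<And>m n. m \<ge> N \<Longrightarrow> n \<ge> N \<Longrightarrow> vdist X (s m) (s n) < e"
    using cauchy_spaceD[OF s \<open>e > 0\<close>] by blast
  have le: "vnorm (s m) \<le> vnorm (s n) + vdist X (s m) (s n)" for m n
  proof -
    \<comment> \<open>The two vectors are not claimed to be equal; their norms agree because the
      form expands to the same value.\<close>
    have "vnorm (s m) = vnorm (vadd X (s n) (vdiff X (s m) (s n)))"
      by (simp add: vnorm_def sX form_simps diff_closed form_diff_left form_diff_right)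
    also have "\<dots> \<le> vnorm (s n) + vdist X (s m) (s n)"
      unfolding vdist_eq by (intro vnorm_triangle sX diff_closed)
    finally show ?thesis .
  qed
  show "\<exists>N. \<forall>m\<ge>N. \<forall>n\<ge>N. dist (vnorm (s m)) (vnorm (s n)) < e"
  proof (intro exI allI impI)
    fix m n assume "m \<ge> N" "n \<ge> N"
    then show "dist (vnorm (s m)) (vnorm (s n)) < e"
      using le[of m n] le[of n m] N[of m n] N[of n m] by (auto simp: dist_real_def)
  qed
qed

lemma convergent_form:
  assumes s: "s \<in> vecs (cauchy_space X)" and t: "t \<in> vecs (cauchy_space X)"
  shows "convergent (\<lambda>n. vform X (s n) (t n))"
proof -
  have X: "s n \<in> vecs X" "t n \<in> vecs X" for n
    using s t by (auto simp: cauchy_space_def)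
  obtain K where K: "K > 0" "\<And>n. vnorm (s n) \<le> K" "\<And>n. vnorm (t n) \<le> K"
  proof -
    obtain K1 K2 where "\<And>n. norm (vnorm (s n)) \<le> K1" "\<And>n. norm (vnorm (t n)) \<le> K2"
      using Cauchy_Bseq[OF cauchy_vnorm[OF s]] Cauchy_Bseq[OF cauchy_vnorm[OF t]]
      by (auto simp: Bseq_def)
    then show ?thesis
      by (intro that[of "max 1 (max K1 K2)"]) (auto intro: order_trans[OF abs_ge_self] simp: le_max_iff_disj)
  qed
  have "Cauchy (\<lambda>n. vform X (s n) (t n))"
  proof (rule metric_CauchyI)
    fix e :: real assume "e > 0"
    then have e: "e / (2 * K) > 0" using K by simp
    obtain N1 where N1: "\<And>m n. m \<ge> N1 \<Longrightarrow> n \<ge> N1 \<Longrightarrow> vdist X (s m) (s n) < e / (2 * K)"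
      using cauchy_spaceD[OF s e] by blast
    obtain N2 where N2: "\<And>m n. m \<ge> N2 \<Longrightarrow> n \<ge> N2 \<Longrightarrow> vdist X (t m) (t n) < e / (2 * K)"
      using cauchy_spaceD[OF t e] by blast
    show "\<exists>N. \<forall>m\<ge>N. \<forall>n\<ge>N. dist (vform X (s m) (t m)) (vform X (s n) (t n)) < e"
    proof (intro exI allI impI)
      fix m n assume mn: "m \<ge> max N1 N2" "n \<ge> max N1 N2"
      have "vform X (s m) (t m) - vform X (s n) (t n)
          = vform X (vdiff X (s m) (s n)) (t m) + vform X (s n) (vdiff X (t m) (t n))"
        by (simp add: X form_diff_left form_diff_right)
      also have "cmod \<dots> \<le> vdist X (s m) (s n) * vnorm (t m) + vnorm (s n) * vdist X (t m) (t n)"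
        unfolding vdist_eq
        by (intro norm_triangle_le add_mono Cauchy_Schwarz X diff_closed)
      also have "\<dots> \<le> vdist X (s m) (s n) * K + K * vdist X (t m) (t n)"
        using K by (intro add_mono mult_mono) (auto simp: vdist_eq X diff_closed vnorm_nonneg)
      also have "\<dots> < e / (2 * K) * K + K * (e / (2 * K))"
        using N1[of m n] N2[of m n] mn K by (intro add_strict_mono mult_strict_right_mono mult_strict_left_mono) auto
      also have "\<dots> = e" using K by simp
      finally show "dist (vform X (s m) (t m)) (vform X (s n) (t n)) < e"
        by (simp add: dist_norm)
    qed
  qed
  then show ?thesis by (simp add: Cauchy_convergent_iff)
qed

lemma cauchy_add:
  assumes s: "s \<in> vecs (cauchy_space X)" and t: "t \<in> vecs (cauchy_space X)"
  shows "(\<lambda>n. vadd X (s n) (t n)) \<in> vecs (cauchy_space X)"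
proof -
  have X: "s n \<in> vecs X" "t n \<in> vecs X" for n
    using s t by (auto simp: cauchy_space_def)
  have "\<exists>N. \<forall>m\<ge>N. \<forall>n\<ge>N. vdist X (vadd X (s m) (t m)) (vadd X (s n) (t n)) < e" if e: "e > 0" for e
  proof -
    obtain N1 where N1: "\<And>m n. m \<ge> N1 \<Longrightarrow> n \<ge> N1 \<Longrightarrow> vdist X (s m) (s n) < e / 2"
      using cauchy_spaceD[OF s half_gt_zero[OF e]] by blast
    obtain N2 where N2: "\<And>m n. m \<ge> N2 \<Longrightarrow> n \<ge> N2 \<Longrightarrow> vdist X (t m) (t n) < e / 2"
      using cauchy_spaceD[OF t half_gt_zero[OF e]] by blast
    have le: "vdist X (vadd X (s m) (t m)) (vadd X (s n) (t n))
        \<le> vdist X (s m) (s n) + vdist X (t m) (t n)" for m n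
    proof -
      have "vdist X (vadd X (s m) (t m)) (vadd X (s n) (t n))
          = vnorm (vadd X (vdiff X (s m) (s n)) (vdiff X (t m) (t n)))"
        unfolding vdist_eq vnorm_def
        by (rule arg_cong[where f = "\<lambda>z. sqrt (Re z)"])
          (simp add: X form_simps diff_closed form_diff_left form_diff_right algebra_simps)
      also have "\<dots> \<le> vdist X (s m) (s n) + vdist X (t m) (t n)"
        unfolding vdist_eq by (intro vnorm_triangle diff_closed X)
      finally show ?thesis .
    qed
    show ?thesis
    proof (intro exI allI impI)
      fix m n assume "m \<ge> max N1 N2" "n \<ge> max N1 N2"
      then show "vdist X (vadd X (s m) (t m)) (vadd X (s n) (t n)) < e"
        using le[of m n] N1[of m n] N2[of m n] by simp
    qed
  qed
  then show ?thesis
    using X by (auto simp: cauchy_space_def add_closed)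
qed

lemma cauchy_scale:
  assumes s: "s \<in> vecs (cauchy_space X)"
  shows "(\<lambda>n. vscale X c (s n)) \<in> vecs (cauchy_space X)"
proof -
  have X: "s n \<in> vecs X" for n
    using s by (auto simp: cauchy_space_def)
  have eq: "vdist X (vscale X c (s m)) (vscale X c (s n)) = cmod c * vdist X (s m) (s n)" for m n
  proof -
    have "vdist X (vscale X c (s m)) (vscale X c (s n)) = vnorm (vscale X c (vdiff X (s m) (s n)))"
      unfolding vdist_eq vnorm_def
      by (rule arg_cong[where f = "\<lambda>z. sqrt (Re z)"])
        (simp add: X form_simps diff_closed form_diff_left form_diff_right algebra_simps)
    then show ?thesis
      by (simp add: vdist_eq vnorm_scale X diff_closed)
  qed
  have "\<exists>N. \<forall>m\<ge>N. \<forall>n\<ge>N. vdist X (vscale X c (s m)) (vscale X c (s n)) < e" if e: "e > 0" for e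
  proof -
    \<comment> \<open>The added 1 keeps the denominator positive when c = 0.\<close>
    have e': "e / (cmod c + 1) > 0" using e by (simp add: add_nonneg_pos)
    obtain N where N: "\<And>m n. m \<ge> N \<Longrightarrow> n \<ge> N \<Longrightarrow> vdist X (s m) (s n) < e / (cmod c + 1)"
      using cauchy_spaceD[OF s e'] by blast
    show ?thesis
    proof (intro exI allI impI)
      fix m n assume "m \<ge> N" "n \<ge> N"
      then have "vdist X (s m) (s n) * (cmod c + 1) < e"
        using N[of m n] by (simp add: pos_less_divide_eq add_nonneg_pos)
      moreover have "vdist X (s m) (s n) \<ge> 0"
        by (simp add: vdist_eq vnorm_nonneg X diff_closed)
      ultimately show "vdist X (vscale X c (s m)) (vscale X c (s n)) < e"
        unfolding eq by (simp add: algebra_simps)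
    qed
  qed
  then show ?thesis
    using X by (auto simp: cauchy_space_def scale_closed)
qed

lemma form_cauchy_LIMSEQ:
  assumes "s \<in> vecs (cauchy_space X)" "t \<in> vecs (cauchy_space X)"
  shows "(\<lambda>n. vform X (s n) (t n)) \<longlonglongrightarrow> vform (cauchy_space X) s t"
  using convergent_form[OF assms] by (simp add: cauchy_space_def convergent_LIMSEQ_iff)

text \<open>The form is a \<open>lim\<close>, which has a usable value only once convergence is
  known. Each law then follows from its pointwise version by uniqueness of limits, and nonnegativity
  because the nonnegative reals are closed.\<close>

lemma psd_cauchy_space: "psd_space (cauchy_space X)"
proof -
  let ?K = "cauchy_space X"
  have add: "vadd ?K s t = (\<lambda>n. vadd X (s n) (t n))" for s t
    by (simp add: cauchy_space_def)
  have scale: "vscale ?K c s = (\<lambda>n. vscale X c (s n))" for c s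
    by (simp add: cauchy_space_def)
  have X: "s n \<in> vecs X" if "s \<in> vecs ?K" for s n
    using that by (auto simp: cauchy_space_def)
  show ?thesis
  proof
    fix s t u assume a: "s \<in> vecs ?K" "t \<in> vecs ?K" "u \<in> vecs ?K"
    show "vform ?K (vadd ?K s t) u = vform ?K s u + vform ?K t u"
      by (rule LIMSEQ_unique[OF form_cauchy_LIMSEQ[OF cauchy_add[OF a(1,2)] a(3), folded add]])
        (use tendsto_add[OF form_cauchy_LIMSEQ[OF a(1,3)] form_cauchy_LIMSEQ[OF a(2,3)]] a in
          \<open>simp add: X add form_simps\<close>)
    show "vform ?K u (vadd ?K s t) = vform ?K u s + vform ?K u t"
      by (rule LIMSEQ_unique[OF form_cauchy_LIMSEQ[OF a(3) cauchy_add[OF a(1,2)], folded add]])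
        (use tendsto_add[OF form_cauchy_LIMSEQ[OF a(3,1)] form_cauchy_LIMSEQ[OF a(3,2)]] a in
          \<open>simp add: X add form_simps\<close>)
  next
    fix s u c assume a: "s \<in> vecs ?K" "u \<in> vecs ?K"
    show "vform ?K (vscale ?K c s) u = cnj c * vform ?K s u"
      by (rule LIMSEQ_unique[OF form_cauchy_LIMSEQ[OF cauchy_scale[OF a(1)] a(2), folded scale]])
        (use tendsto_mult_left[OF form_cauchy_LIMSEQ[OF a], of "cnj c"] a in
          \<open>simp add: X scale form_simps\<close>)
    show "vform ?K u (vscale ?K c s) = c * vform ?K u s"
      by (rule LIMSEQ_unique[OF form_cauchy_LIMSEQ[OF a(2) cauchy_scale[OF a(1)], folded scale]])
        (use tendsto_mult_left[OF form_cauchy_LIMSEQ[OF a(2,1)], of c] a in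
          \<open>simp add: X scale form_simps\<close>)
  next
    fix s assume s: "s \<in> vecs ?K"
    show "vform ?K s s \<in> \<real>\<^sub>\<ge>\<^sub>0"
      by (rule closed_sequentially[OF closed_nonneg_Reals_complex _ form_cauchy_LIMSEQ[OF s s]])
        (auto intro: form_nonneg X[OF s])
  qed (auto simp: add scale intro: cauchy_add cauchy_scale)
qed

lemma unit_vector_cauchy_space:
  assumes x: "x \<in> vecs X" "vform X x x = 1"
  shows "\<exists>s\<in>vecs (cauchy_space X). vform (cauchy_space X) s s = 1"
  using assms
  by (intro bexI[of _ "\<lambda>_. x"])
    (auto simp: cauchy_space_def vdist_eq vnorm_diff_self)

lemma null_quotient_form_zero:
  assumes zero: "\<And>x. x \<in> vecs X \<Longrightarrow> vform X x x = 0" and A: "A \<in> vecs (null_quotient X)"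
  shows "vform (null_quotient X) A A = 0"
  using A zero rep_in_vecs by (simp add: null_quotient_def Let_def)

lemma cauchy_space_form_zero:
  assumes zero: "\<And>x. x \<in> vecs X \<Longrightarrow> vform X x x = 0" and s: "s \<in> vecs (cauchy_space X)"
  shows "vform (cauchy_space X) s s = 0"
proof (rule LIMSEQ_unique[OF form_cauchy_LIMSEQ[OF s s]])
  have "s n \<in> vecs X" for n using s by (auto simp: cauchy_space_def)
  then show "(\<lambda>n. vform X (s n) (s n)) \<longlonglongrightarrow> 0" by (simp add: zero)
qed

lemma unit_vector:
  assumes x: "x \<in> vecs X" "vform X x x \<noteq> 0"
  shows "\<exists>y\<in>vecs X. vform X y y = 1"
proof (intro bexI)
  let ?y = "vscale X (complex_of_real (inverse (vnorm x))) x"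
  show "?y \<in> vecs X" by (simp add: scale_closed x)
  have "vnorm x \<noteq> 0" using x by (simp add: form_self)
  then have "vnorm ?y = 1"
    using vnorm_nonneg[OF x(1)] by (simp add: vnorm_scale x norm_inverse)
  then show "vform X ?y ?y = 1" by (simp add: form_self scale_closed x)
qed

end

section \<open>Vanishing of the Hilbert space dimension\<close>

lemma unit_vector_completion:
  assumes "psd_space X" "x \<in> vecs X" "vform X x x = 1"
  shows "\<exists>A\<in>vecs (completion X). vform (completion X) A A = 1"
  unfolding completion_def
  using psd_space.unit_vector_cauchy_space[OF assms]
    psd_space.unit_vector_null_quotient[OF psd_space.psd_cauchy_space[OF assms(1)]]
  by blast

text \<open>Zorn's lemma: any two elements of the union of a chain lie in a common member, which
  settles the pairwise condition. This makes the choice in \<open>hilbert_dim\<close> a genuine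
  basis.\<close>

lemma orthonormal_basis_exists: "\<exists>B. orthonormal_basis X B"
proof -
  have "\<exists>B\<in>Collect (orthonormal X). \<forall>C\<in>Collect (orthonormal X). B \<subseteq> C \<longrightarrow> C = B"
  proof (rule subset_Zorn')
    fix \<C> assume C: "subset.chain (Collect (orthonormal X)) \<C>"
    have "\<exists>D\<in>\<C>. a \<in> D \<and> b \<in> D" if "a \<in> \<Union>\<C>" "b \<in> \<Union>\<C>" for a b
      using C that unfolding subset_chain_def by blast
    moreover have "\<And>D. D \<in> \<C> \<Longrightarrow> orthonormal X D"
      using C by (auto simp: subset_chain_def)
    ultimately show "\<Union>\<C> \<in> Collect (orthonormal X)"
      unfolding orthonormal_def mem_Collect_eq by (smt (verit) Union_iff subset_iff)
  qed
  then show ?thesis by (auto simp: orthonormal_basis_def)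
qed

text \<open>A unit vector is the same as an orthonormal singleton, so the empty set is maximal
  exactly when there is none. The type of \<open>czero\<close> is free because \<open>=o\<close>
  compares cardinals over different types.\<close>

lemma hilbert_dim_eq_0_iff:
  "hilbert_dim X =o (czero :: 'b rel) \<longleftrightarrow> (\<forall>x\<in>vecs X. vform X x x \<noteq> 1)"
proof -
  define B where "B = (SOME B. orthonormal_basis X B)"
  have B: "orthonormal_basis X B"
    unfolding B_def by (rule someI_ex[OF orthonormal_basis_exists])
  have "B = {} \<longleftrightarrow> (\<forall>x\<in>vecs X. vform X x x \<noteq> 1)"
  proof
    assume "B = {}"
    then have "\<not> orthonormal X {x}" for x
      using B by (auto simp: orthonormal_basis_def)
    then show "\<forall>x\<in>vecs X. vform X x x \<noteq> 1"
      by (simp add: orthonormal_def)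
  next
    assume "\<forall>x\<in>vecs X. vform X x x \<noteq> 1"
    then show "B = {}"
      using B by (fastforce simp: orthonormal_basis_def orthonormal_def)
  qed
  then show ?thesis
    by (simp add: hilbert_dim_def card_of_ordIso_czero_iff_empty flip: B_def)
qed

text \<open>A vector with nonzero square is normalised in \<open>X\<close> itself; as a unit vector
  it survives as its class, then as a constant sequence and the class of that. Conversely, vanishing
  on the diagonal passes to representatives and to limits.\<close>

theorem (in psd_space) hilbert_dim_completion_eq_0_iff:
  "hilbert_dim (completion (null_quotient X)) =o (czero :: 'b rel) \<longleftrightarrow>
    (\<forall>x\<in>vecs X. vform X x x = 0)"
proof -
  interpret Q: psd_space "null_quotient X" by (rule psd_null_quotient)
  interpret K: psd_space "cauchy_space (null_quotient X)" by (rule Q.psd_cauchy_space)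
  show ?thesis
    unfolding hilbert_dim_eq_0_iff
  proof
    assume no_unit: "\<forall>x\<in>vecs (completion (null_quotient X)).
      vform (completion (null_quotient X)) x x \<noteq> 1"
    show "\<forall>x\<in>vecs X. vform X x x = 0"
    proof (rule ccontr)
      assume "\<not> ?thesis"
      then obtain x where "x \<in> vecs X" "vform X x x = 1" using unit_vector by blast
      then obtain A where "A \<in> vecs (null_quotient X)" "vform (null_quotient X) A A = 1"
        using unit_vector_null_quotient by blast
      then show False using unit_vector_completion[OF Q.psd_space_axioms] no_unit by blast
    qed
  next
    assume "\<forall>x\<in>vecs X. vform X x x = 0"
    then have "vform (null_quotient X) A A = 0" if "A \<in> vecs (null_quotient X)" for A
      using null_quotient_form_zero that by blast
    then have "vform (cauchy_space (null_quotient X)) s s = 0"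
      if "s \<in> vecs (cauchy_space (null_quotient X))" for s
      using Q.cauchy_space_form_zero that by blast
    then have "vform (completion (null_quotient X)) x x = 0"
      if "x \<in> vecs (completion (null_quotient X))" for x
      using K.null_quotient_form_zero that unfolding completion_def by blast
    then show "\<forall>x\<in>vecs (completion (null_quotient X)).
      vform (completion (null_quotient X)) x x \<noteq> 1"
      by simp
  qed
qed

section \<open>Operators on a complex Hilbert space\<close>

lemma cinner_add_left: "cinner (x + y) z = cinner x z + cinner y (z::'a::chilbert_space)"
  by (metis cinner_add_right cinner_commute complex_cnj_add)

lemma cinner_scaleC_left: "cinner (c *\<^sub>C x) y = cnj c * cinner x (y::'a::chilbert_space)"
  by (metis cinner_commute cinner_scaleC_right complex_cnj_mult)

lemma psd_cinner:
  "psd_space \<lparr>vecs = (UNIV :: 'a::chilbert_space set), vadd = (+), vscale = (*\<^sub>C), vform = cinner\<rparr>"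
  by unfold_locales
    (simp_all add: cinner_add_left cinner_add_right cinner_scaleC_left cinner_scaleC_right
      cinner_self complex_nonneg_Reals_iff)

lemma cinner_Cauchy_Schwarz: "cmod (cinner x y) \<le> norm x * norm (y::'a::chilbert_space)"
  using psd_space.Cauchy_Schwarz[OF psd_cinner, of x y]
  by (simp add: psd_space.vnorm_def[OF psd_cinner] cinner_self)

lemma bounded_bilinear_cinner: "bounded_bilinear (cinner :: 'a::chilbert_space \<Rightarrow> _)"
proof
  show "\<exists>K. \<forall>a b::'a. norm (cinner a b) \<le> norm a * norm b * K"
    by (rule exI[of _ 1]) (simp add: cinner_Cauchy_Schwarz)
qed (simp_all add: cinner_add_left cinner_add_right scaleR_scaleC cinner_scaleC_left
    cinner_scaleC_right scaleR_conv_of_real)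

interpretation cinner: bounded_bilinear "cinner :: 'a::chilbert_space \<Rightarrow> 'a \<Rightarrow> complex"
  by (rule bounded_bilinear_cinner)

lemma cinner_eqI: "(\<And>x. cinner x y = cinner x z) \<Longrightarrow> y = (z::'a::chilbert_space)"
  by (metis cinner.diff_right cinner_self diff_self norm_eq_zero of_real_eq_0_iff
      power_eq_0_iff right_minus_eq)

lemma norm_diff_square:
  "(norm (x - y))\<^sup>2 = (norm x)\<^sup>2 - 2 * Re (cinner x y) + (norm (y::'a::chilbert_space))\<^sup>2"
proof -
  have "complex_of_real ((norm (x - y))\<^sup>2) = cinner x x - cinner x y - cinner y x + cinner y y"
    unfolding cinner_self[symmetric] by (simp add: cinner.diff_left cinner.diff_right)
  then show ?thesis
    using arg_cong[OF cinner_commute[of y x], of Re]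
    by (simp add: cinner_self complex_eq_iff)
qed

lemma norm_add_square:
  "(norm (x + y))\<^sup>2 = (norm x)\<^sup>2 + 2 * Re (cinner x y) + (norm (y::'a::chilbert_space))\<^sup>2"
  using norm_diff_square[of x "- y"] by (simp add: cinner.minus_right)

section \<open>Minimizing sequences and the Riesz representation\<close>

lemma INF_sequence:
  fixes J :: "'a \<Rightarrow> real"
  assumes "C \<noteq> {}"
  shows "\<exists>z. \<forall>n. z n \<in> C \<and> J (z n) < (INF z\<in>C. J z) + inverse (real (Suc n))"
proof -
  have "\<exists>z\<in>C. J z < (INF z\<in>C. J z) + inverse (real (Suc n))" for n
  proof (rule ccontr)
    assume "\<not> ?thesis"
    then have "(INF z\<in>C. J z) + inverse (real (Suc n)) \<le> (INF z\<in>C. J z)"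
      using assms by (intro cINF_greatest) (auto simp: not_less)
    then show False by simp
  qed
  then show ?thesis by metis
qed

text \<open>The representing vector is the minimizer of \<open>z \<mapsto> \<parallel>z\<parallel>\<^sup>2 - 2 Re (f z)\<close>.\<close>

lemma Riesz_representation:
  fixes f :: "'a::chilbert_space \<Rightarrow> complex"
  assumes add: "\<And>x y. f (x + y) = f x + f y"
    and scale: "\<And>c x. f (c *\<^sub>C x) = c * f x"
    and bound: "\<And>x. cmod (f x) \<le> K * norm x"
  shows "\<exists>z. \<forall>x. f x = cinner z x"
proof -
  define J where "J z = (norm z)\<^sup>2 - 2 * Re (f z)" for z
  define m where "m = (INF z. J z)"
  have lower: "J z \<ge> - K\<^sup>2" for z
  proof -
    have "Re (f z) \<le> K * norm z"
      using bound[of z] complex_Re_le_cmod[of "f z"] by linarith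
    then show ?thesis
      using zero_le_power2[of "norm z - K"] by (simp add: J_def power2_eq_square algebra_simps)
  qed
  then have m: "m \<le> J z" for z
    unfolding m_def by (intro cINF_lower) (auto intro: bdd_belowI[of _ "- K\<^sup>2"])
  obtain z where z: "\<And>n. J (z n) < m + inverse (real (Suc n))"
    using INF_sequence[of UNIV J] by (auto simp: m_def)
  have scaleR: "f (r *\<^sub>R x) = of_real r * f x" for r x
    by (simp add: scaleR_scaleC scale)
  \<comment> \<open>Parallelogram law with the midpoint of \<open>x\<close> and \<open>y\<close>,
    where \<open>J\<close> is at least \<open>m\<close>: almost minimal vectors are close together,
    so a minimizing sequence is Cauchy.\<close>
  have par: "(norm (x - y))\<^sup>2 \<le> 2 * (J x - m) + 2 * (J y - m)" for x y
  proof -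
    have Jmid: "J ((1/2) *\<^sub>R (x + y)) = (norm (x + y))\<^sup>2 / 4 - Re (f x) - Re (f y)"
      by (simp add: J_def scaleR add power_divide add_divide_distrib del: scaleR_add_right)
    then show ?thesis
      using m[of "(1/2) *\<^sub>R (x + y)"] norm_diff_square[of x y] norm_add_square[of x y]
        J_def[of x] J_def[of y] unfolding Jmid by argo
  qed
  have "Cauchy z"
  proof (rule metric_CauchyI)
    fix e :: real assume "e > 0"
    \<comment> \<open>\<open>par\<close> bounds the squared distance by four times this error, hence
      e^2 / 4.\<close>
    then obtain N where N: "inverse (real (Suc N)) < e\<^sup>2 / 4"
      using reals_Archimedean[of "e\<^sup>2 / 4"] by auto
    show "\<exists>M. \<forall>m\<ge>M. \<forall>n\<ge>M. dist (z m) (z n) < e"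
    proof (intro exI allI impI)
      fix i j assume ij: "i \<ge> N" "j \<ge> N"
      have "inverse (real (Suc i)) \<le> inverse (real (Suc N))"
        "inverse (real (Suc j)) \<le> inverse (real (Suc N))"
        using ij by (auto simp: inverse_eq_divide intro!: divide_left_mono)
      then have "(norm (z i - z j))\<^sup>2 < e\<^sup>2"
        using par[of "z i" "z j"] z[of i] z[of j] N by argo
      then show "dist (z i) (z j) < e"
        using \<open>e > 0\<close> by (simp add: dist_norm power2_less_imp_less)
    qed
  qed
  then obtain w where w: "z \<longlonglongrightarrow> w"
    using Cauchy_convergent convergent_def by blast
  interpret f: bounded_linear f
    by (rule bounded_linear_intro[of f K])
      (simp_all add: add scaleR scaleR_conv_of_real bound mult.commute)
  have "(\<lambda>n. J (z n)) \<longlonglongrightarrow> J w"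
    unfolding J_def by (intro tendsto_intros w f.tendsto)
  moreover have "(\<lambda>n. m + inverse (real (Suc n))) \<longlonglongrightarrow> m"
    by (rule LIMSEQ_inverse_real_of_nat_add)
  ultimately have Jw: "J w \<le> m"
    by (rule LIMSEQ_le) (use z in \<open>auto intro: less_imp_le\<close>)
  \<comment> \<open>First variation: \<open>J\<close> at w - t x is a quadratic in \<open>t\<close>
    with linear coefficient -2 \<open>a\<close>, and minimality at t = 0 forces a = 0.\<close>
  have Re_eq: "Re (f x) = Re (cinner w x)" for x
  proof (rule ccontr)
    assume neq: "Re (f x) \<noteq> Re (cinner w x)"
    define a where "a = Re (cinner w x) - Re (f x)"
    have J_eq: "J (w - t *\<^sub>R x) = J w - 2 * t * a + t\<^sup>2 * (norm x)\<^sup>2" for t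
      by (simp add: J_def norm_diff_square f.diff scaleR cinner.scaleR_right a_def
          power_mult_distrib algebra_simps)
    have "2 * t * a \<le> t\<^sup>2 * (norm x)\<^sup>2" for t
      using J_eq[of t] m[of "w - t *\<^sub>R x"] Jw by linarith
    \<comment> \<open>Close to the optimal step a / |x|^2, with 1 added so that x = 0 is covered as
      well.\<close>
    from this[of "a / ((norm x)\<^sup>2 + 1)"]
    have "2 * a\<^sup>2 / ((norm x)\<^sup>2 + 1) \<le> a\<^sup>2 * (norm x)\<^sup>2 / ((norm x)\<^sup>2 + 1)\<^sup>2"
      by (simp add: power_divide power2_eq_square)
    moreover have "(norm x)\<^sup>2 + 1 > 0" by (simp add: add_nonneg_pos)
    ultimately have "2 * a\<^sup>2 * ((norm x)\<^sup>2 + 1) \<le> a\<^sup>2 * (norm x)\<^sup>2"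
      by (simp add: divide_simps power2_eq_square mult.assoc split: if_splits)
    moreover have "a\<^sup>2 > 0" "a\<^sup>2 * (norm x)\<^sup>2 \<ge> 0" using neq by (auto simp: a_def)
    ultimately show False by (simp add: algebra_simps)
  qed
  have "f x = cinner w x" for x
    \<comment> \<open>The imaginary part of a complex-linear functional at \<open>x\<close> is minus
      its real part at i x.\<close>
    using Re_eq[of x] Re_eq[of "\<i> *\<^sub>C x"] by (simp add: scale cinner_scaleC_right complex_eq_iff)
  then show ?thesis by blast
qed

lemma bopsD: "T \<in> bops \<Longrightarrow> blinfun_apply T (c *\<^sub>C x) = c *\<^sub>C blinfun_apply T x"
  by (simp add: bops_def)

text \<open>For fixed \<open>y\<close> the conjugate of B x y is a bounded linear functional of
  \<open>x\<close>, so Riesz supplies the vector T y. This is the source of operators below: it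
  yields adjoints and weak limits.\<close>

lemma sesquilinear_operator:
  fixes B :: "'a::chilbert_space \<Rightarrow> 'a \<Rightarrow> complex"
  assumes add_left: "\<And>x y z. B (x + y) z = B x z + B y z"
    and scale_left: "\<And>c x z. B (c *\<^sub>C x) z = cnj c * B x z"
    and add_right: "\<And>x y z. B z (x + y) = B z x + B z y"
    and scale_right: "\<And>c x z. B z (c *\<^sub>C x) = c * B z x"
    and K: "K \<ge> 0"
    and bound: "\<And>x y. cmod (B x y) \<le> K * norm x * norm y"
  shows "\<exists>T\<in>bops. norm T \<le> K \<and> (\<forall>x y. B x y = cinner x (blinfun_apply T y))"
proof -
  have "\<exists>z. \<forall>x. B x y = cinner x z" for y
  proof -
    have "\<exists>z. \<forall>x. cnj (B x y) = cinner z x"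
      by (rule Riesz_representation[where K = "K * norm y"])
        (use bound in \<open>simp_all add: add_left scale_left mult.commute mult.left_commute\<close>)
    then show ?thesis by (metis cinner_commute complex_cnj_cnj)
  qed
  then obtain T where T: "\<And>x y. B x y = cinner x (T y)" by metis
  have add: "T (x + y) = T x + T y" for x y
    by (rule cinner_eqI) (simp add: add_right cinner_add_right flip: T)
  have scale: "T (c *\<^sub>C x) = c *\<^sub>C T x" for c x
    by (rule cinner_eqI) (simp add: scale_right cinner_scaleC_right flip: T)
  have norm: "norm (T y) \<le> K * norm y" for y
  proof (cases "norm (T y) = 0")
    case True
    then show ?thesis using K by simp
  next
    case False
    have "(norm (T y))\<^sup>2 = cmod (B (T y) y)"
      by (simp add: T cinner_self del: of_real_power)
    also have "\<dots> \<le> K * norm (T y) * norm y" by (rule bound)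
    finally show ?thesis
      using False by (simp add: power2_eq_square algebra_simps)
  qed
  have lin: "bounded_linear T"
    by (rule bounded_linear_intro[where K = K]) (simp_all add: add scaleR_scaleC scale norm mult.commute)
  show ?thesis
  proof (intro bexI[of _ "Blinfun T"] conjI allI)
    show "norm (Blinfun T) \<le> K"
      by (intro norm_blinfun_bound K) (simp_all add: bounded_linear_Blinfun_apply lin norm)
  qed (simp_all add: bops_def bounded_linear_Blinfun_apply lin scale T)
qed


section \<open>Adjoints\<close>

context
  fixes T :: "'a::chilbert_space op"
  assumes T: "T \<in> bops"
begin

lemma op_adj_exists: "\<exists>S\<in>bops. norm S \<le> norm T \<and>
    (\<forall>x y. cinner (blinfun_apply S x) y = cinner x (blinfun_apply T y))"
proof -
  have "\<exists>S\<in>bops. norm S \<le> norm T \<and>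
    (\<forall>x y. cinner (blinfun_apply T x) y = cinner x (blinfun_apply S y))"
  proof (rule sesquilinear_operator)
    fix x y
    have "cmod (cinner (blinfun_apply T x) y) \<le> norm (blinfun_apply T x) * norm y"
      by (rule cinner_Cauchy_Schwarz)
    also have "\<dots> \<le> norm T * norm x * norm y"
      by (intro mult_right_mono norm_blinfun) auto
    finally show "cmod (cinner (blinfun_apply T x) y) \<le> norm T * norm x * norm y" .
  qed (simp_all add: bopsD[OF T] blinfun.add_right cinner_add_left cinner_add_right
      cinner_scaleC_left cinner_scaleC_right)
  then show ?thesis by (metis cinner_commute)
qed

text \<open>Resolves the definite description in \<open>op_adj\<close>. The algebraic rules for
  adjoints then amount to checking the defining relation for a candidate.\<close>

lemma op_adj_unique:
  assumes "\<And>x y. cinner (blinfun_apply S x) y = cinner x (blinfun_apply T y)"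
  shows "op_adj T = S"
  unfolding op_adj_def
proof (rule the_equality)
  fix S' assume "\<forall>x y. cinner (blinfun_apply S' x) y = cinner x (blinfun_apply T y)"
  then have "cinner y (blinfun_apply S' x) = cinner y (blinfun_apply S x)" for x y
    using assms by (metis cinner_commute)
  then show "S' = S"
    by (intro blinfun_eqI cinner_eqI)
qed (use assms in blast)

lemma op_adj_bops: "op_adj T \<in> bops"
  and norm_op_adj_le: "norm (op_adj T) \<le> norm T"
  and cinner_op_adj_left: "cinner (blinfun_apply (op_adj T) x) y = cinner x (blinfun_apply T y)"
  using op_adj_exists op_adj_unique by metis+

lemma cinner_op_adj_right: "cinner x (blinfun_apply (op_adj T) y) = cinner (blinfun_apply T x) y"
  by (metis cinner_commute cinner_op_adj_left)

end

lemma op_scale_apply [simp]: "blinfun_apply (c *\<^sub>O T) x = c *\<^sub>C blinfun_apply T x"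
  by (simp add: op_scale.rep_eq)

lemma scaleC_one [simp]: "1 *\<^sub>C x = (x::'a::chilbert_space)"
  using scaleR_scaleC[of 1 x] by simp

lemma scaleC_zero_left [simp]: "0 *\<^sub>C x = (0::'a::chilbert_space)"
  using scaleR_scaleC[of 0 x] by simp

lemma op_scale_one [simp]: "1 *\<^sub>O T = T"
  by (rule blinfun_eqI) simp

lemma op_scale_scale: "c *\<^sub>O d *\<^sub>O T = (c * d) *\<^sub>O T"
  by (rule blinfun_eqI) (simp add: scaleC_scaleC)

lemma bops_id: "id_blinfun \<in> bops"
  and bops_add: "S \<in> bops \<Longrightarrow> T \<in> bops \<Longrightarrow> S + T \<in> bops"
  and bops_compose: "S \<in> bops \<Longrightarrow> T \<in> bops \<Longrightarrow> S o\<^sub>L T \<in> bops"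
  and bops_scale: "T \<in> bops \<Longrightarrow> c *\<^sub>O T \<in> bops"
  by (auto simp: bops_def blinfun.add_left scaleC_add_right scaleC_scaleC mult.commute
      intro: bounded_linear_scaleC[THEN linear_simps(3)])

lemma op_adj_adj: "T \<in> bops \<Longrightarrow> op_adj (op_adj T) = T"
  by (rule op_adj_unique) (simp_all add: op_adj_bops cinner_op_adj_right)

lemma op_adj_id: "op_adj id_blinfun = id_blinfun"
  by (rule op_adj_unique) (simp_all add: bops_id)

lemma op_adj_add: "S \<in> bops \<Longrightarrow> T \<in> bops \<Longrightarrow> op_adj (S + T) = op_adj S + op_adj T"
  by (rule op_adj_unique)
    (simp_all add: bops_add blinfun.add_left cinner_op_adj_left cinner_add_left cinner_add_right)

lemma op_adj_scale: "T \<in> bops \<Longrightarrow> op_adj (c *\<^sub>O T) = cnj c *\<^sub>O op_adj T"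
  by (rule op_adj_unique)
    (simp_all add: bops_scale cinner_op_adj_left cinner_scaleC_left cinner_scaleC_right)

lemma op_adj_compose: "S \<in> bops \<Longrightarrow> T \<in> bops \<Longrightarrow> op_adj (S o\<^sub>L T) = op_adj T o\<^sub>L op_adj S"
  by (rule op_adj_unique) (simp_all add: bops_compose cinner_op_adj_left)

lemma compose_scale_left: "(c *\<^sub>O S) o\<^sub>L T = c *\<^sub>O (S o\<^sub>L T)"
  by (rule blinfun_eqI) simp

lemma compose_scale_right: "S \<in> bops \<Longrightarrow> S o\<^sub>L (c *\<^sub>O T) = c *\<^sub>O (S o\<^sub>L T)"
  by (rule blinfun_eqI) (simp add: bopsD)

lemma compose_add_left: "(S + S') o\<^sub>L T = (S o\<^sub>L T) + (S' o\<^sub>L T)"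
  by (rule bounded_bilinear.add_left[OF bounded_bilinear_blinfun_compose])

lemma compose_add_right: "T o\<^sub>L (S + S') = (T o\<^sub>L S) + (T o\<^sub>L S')"
  by (rule bounded_bilinear.add_right[OF bounded_bilinear_blinfun_compose])

lemma compose_id [simp]: "id_blinfun o\<^sub>L T = T" "T o\<^sub>L id_blinfun = T"
  by (auto intro: blinfun_eqI)

lemma op_scale_minus_one: "(-1) *\<^sub>O T = - T"
  by (rule blinfun_eqI)
    (use scaleR_scaleC[of "-1" "blinfun_apply T _"] in \<open>simp add: blinfun.minus_left\<close>)

lemma op_scale_of_real: "complex_of_real r *\<^sub>O T = r *\<^sub>R T"
  by (rule blinfun_eqI) (simp add: scaleR_scaleC blinfun.scaleR_left)

lemma op_scale_uminus: "(- c) *\<^sub>O T = c *\<^sub>O (- T)"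
  using op_scale_scale[of c "-1" T] by (simp add: op_scale_minus_one)

lemma op_adj_minus: "T \<in> bops \<Longrightarrow> op_adj (- T) = - op_adj T"
  using op_adj_scale[of T "-1"] by (simp add: op_scale_minus_one)

lemma compose_assoc: "(R o\<^sub>L S) o\<^sub>L T = R o\<^sub>L (S o\<^sub>L T)"
  by (rule blinfun_eqI) simp

lemma norm_unitary:
  assumes "unitary U" shows "norm U \<le> 1"
proof (rule norm_blinfun_bound)
  fix x
  have U: "U \<in> bops" "op_adj U o\<^sub>L U = id_blinfun" using assms by (auto simp: unitary_def)
  have "cinner (blinfun_apply U x) (blinfun_apply U x) = cinner x (blinfun_apply (op_adj U o\<^sub>L U) x)"
    by (simp add: cinner_op_adj_right U(1))
  then show "norm (blinfun_apply U x) \<le> 1 * norm x"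
    by (simp add: U cinner_self flip: of_real_power)
qed simp

lemma bounded_linear_scaleC_left: "bounded_linear (\<lambda>c. c *\<^sub>C (x::'a::chilbert_space))"
  by (rule bounded_linear_intro[where K = "norm x"])
    (simp_all add: scaleC_add_left scaleR_scaleC scaleC_scaleC scaleR_conv_of_real norm_scaleC)

lemma unitary_scale_id:
  assumes "cmod c = 1" shows "unitary (c *\<^sub>O (id_blinfun :: 'h::chilbert_space op))"
proof -
  have "cnj c * c = 1" using assms by (simp add: complex_norm_square[symmetric] mult.commute)
  then show ?thesis
    unfolding unitary_def
    by (simp add: bops_scale bops_id op_adj_scale op_adj_id compose_scale_left op_scale_scale mult.commute)
qed

section \<open>Von Neumann algebras\<close>

locale vn_algebra =
  fixes M :: "'h::chilbert_space op set"
  assumes vn: "von_neumann_algebra M"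
begin

lemma bops: "T \<in> M \<Longrightarrow> T \<in> bops"
  and adj: "T \<in> M \<Longrightarrow> op_adj T \<in> M"
  and bicommutant: "commutant (commutant M) = M"
  using vn by (auto simp: von_neumann_algebra_def)

text \<open>The bicommutant property as a membership test: closure of \<open>M\<close> under the
  operations reduces to algebra with commuting operators.\<close>

lemma memI: "T \<in> bops \<Longrightarrow> (\<And>A. A \<in> commutant M \<Longrightarrow> T o\<^sub>L A = A o\<^sub>L T) \<Longrightarrow> T \<in> M"
  by (subst bicommutant[symmetric]) (simp add: commutant_def)

lemma commutantD: "A \<in> commutant M \<Longrightarrow> A \<in> bops" "A \<in> commutant M \<Longrightarrow> T \<in> M \<Longrightarrow> T o\<^sub>L A = A o\<^sub>L T"
  by (auto simp: commutant_def)

lemma id: "id_blinfun \<in> M"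
  by (rule memI) (auto simp: bops_id)

lemma add: "S \<in> M \<Longrightarrow> T \<in> M \<Longrightarrow> S + T \<in> M"
  by (rule memI) (auto simp: bops_add bops compose_add_left compose_add_right commutantD)

lemma scale: "T \<in> M \<Longrightarrow> c *\<^sub>O T \<in> M"
  by (rule memI) (auto simp: bops_scale bops compose_scale_left compose_scale_right commutantD)

lemma compose: "S \<in> M \<Longrightarrow> T \<in> M \<Longrightarrow> S o\<^sub>L T \<in> M"
  by (rule memI) (auto simp: bops_compose bops, metis compose_assoc commutantD(2))

lemma minus: "T \<in> M \<Longrightarrow> - T \<in> M"
  using scale[of T "-1"] by (simp add: op_scale_minus_one)

lemma diff: "S \<in> M \<Longrightarrow> T \<in> M \<Longrightarrow> S - T \<in> M"
  using add[of S "- T"] minus[of T] by simp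

lemma zero: "0 \<in> M"
  using diff[OF id id] by simp

lemma sum: "(\<And>i. i \<in> I \<Longrightarrow> f i \<in> M) \<Longrightarrow> sum f I \<in> M"
  by (induction I rule: infinite_finite_induct) (auto simp: zero add)

end

section \<open>Normal functionals\<close>

lemma predual_summable:
  fixes \<xi> \<eta> :: "nat \<Rightarrow> 'h::chilbert_space"
  assumes "summable (\<lambda>n. (norm (\<xi> n))\<^sup>2)" "summable (\<lambda>n. (norm (\<eta> n))\<^sup>2)"
  shows "summable (\<lambda>n. norm (\<xi> n) * norm (\<eta> n))"
proof (rule summable_comparison_test')
  show "summable (\<lambda>n. (norm (\<xi> n))\<^sup>2 + (norm (\<eta> n))\<^sup>2)"
    using assms by (rule summable_add)
  fix n
  show "norm (norm (\<xi> n) * norm (\<eta> n)) \<le> (norm (\<xi> n))\<^sup>2 + (norm (\<eta> n))\<^sup>2"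
    using sum_squares_bound[of "norm (\<xi> n)" "norm (\<eta> n)"]
      mult_nonneg_nonneg[OF norm_ge_zero norm_ge_zero, of "\<xi> n" "\<eta> n"]
    by (simp only: real_norm_def)
qed

lemma norm_cinner_apply_le:
  "cmod (cinner x (blinfun_apply T y)) \<le> norm T * (norm x * norm (y::'h::chilbert_space))"
proof -
  have "cmod (cinner x (blinfun_apply T y)) \<le> norm x * norm (blinfun_apply T y)"
    by (rule cinner_Cauchy_Schwarz)
  also have "\<dots> \<le> norm x * (norm T * norm y)"
    by (intro mult_left_mono norm_blinfun) auto
  finally show ?thesis by (simp add: mult_ac)
qed

lemma predualE:
  assumes "\<rho> \<in> predual M"
  obtains \<xi> \<eta> where "summable (\<lambda>n. norm (\<xi> n) * norm (\<eta> n))"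
    "summable (\<lambda>n. (norm (\<xi> n))\<^sup>2)" "summable (\<lambda>n. (norm (\<eta> n))\<^sup>2)"
    "\<And>x. x \<in> M \<Longrightarrow> \<rho> x = (\<Sum>n. cinner (\<xi> n) (blinfun_apply x (\<eta> n)))"
    "\<And>x. summable (\<lambda>n. cinner (\<xi> n) (blinfun_apply x (\<eta> n)))"
proof -
  obtain \<xi> \<eta> :: "nat \<Rightarrow> 'a" where *: "summable (\<lambda>n. (norm (\<xi> n))\<^sup>2)" "summable (\<lambda>n. (norm (\<eta> n))\<^sup>2)"
    "\<And>x. x \<in> M \<Longrightarrow> \<rho> x = (\<Sum>n. cinner (\<xi> n) (blinfun_apply x (\<eta> n)))"
    using assms by (auto simp: predual_def)
  have "summable (\<lambda>n. cinner (\<xi> n) (blinfun_apply x (\<eta> n)))" for x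
    by (rule summable_comparison_test'[OF summable_mult[OF predual_summable[OF *(1,2)]]])
      (rule norm_cinner_apply_le)
  then show ?thesis
    using that predual_summable[OF *(1,2)] * by blast
qed

context vn_algebra
begin

context
  fixes \<rho> assumes \<rho>: "\<rho> \<in> predual M"
begin

lemma predual_add: "x \<in> M \<Longrightarrow> y \<in> M \<Longrightarrow> \<rho> (x + y) = \<rho> x + \<rho> y"
  by (rule predualE[OF \<rho>]) (simp add: add suminf_add blinfun.add_left cinner_add_right)

lemma predual_scale: "x \<in> M \<Longrightarrow> \<rho> (c *\<^sub>O x) = c * \<rho> x"
  by (rule predualE[OF \<rho>]) (simp add: scale suminf_mult cinner_scaleC_right)

lemma predual_minus: "x \<in> M \<Longrightarrow> \<rho> (- x) = - \<rho> x"
  using predual_scale[of x "-1"] by (simp add: op_scale_minus_one)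

lemma predual_diff: "x \<in> M \<Longrightarrow> y \<in> M \<Longrightarrow> \<rho> (x - y) = \<rho> x - \<rho> y"
  using predual_add[of x "- y"] by (simp add: predual_minus minus)

lemma predual_zero: "\<rho> 0 = 0"
  using predual_diff[OF zero zero] by simp

lemma predual_sum: "(\<And>i. i \<in> I \<Longrightarrow> f i \<in> M) \<Longrightarrow> \<rho> (sum f I) = (\<Sum>i\<in>I. \<rho> (f i))"
  by (induction I rule: infinite_finite_induct) (auto simp: predual_zero predual_add sum)

text \<open>Moving \<open>a\<close> across the inner product replaces each vector on the left by its
  image under the adjoint of \<open>a\<close>, and square summability persists.\<close>

lemma predual_mult_left:
  assumes a: "a \<in> M" shows "(\<lambda>x. \<rho> (a o\<^sub>L x)) \<in> predual M"
proof (rule predualE[OF \<rho>])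
  fix \<xi> \<eta> :: "nat \<Rightarrow> 'h"
  assume *: "summable (\<lambda>n. (norm (\<xi> n))\<^sup>2)" "summable (\<lambda>n. (norm (\<eta> n))\<^sup>2)"
    "\<And>x. x \<in> M \<Longrightarrow> \<rho> x = (\<Sum>n. cinner (\<xi> n) (blinfun_apply x (\<eta> n)))"
  define \<xi>' where "\<xi>' n = blinfun_apply (op_adj a) (\<xi> n)" for n
  have "summable (\<lambda>n. (norm (\<xi>' n))\<^sup>2)"
  proof (rule summable_comparison_test'[OF summable_mult[OF *(1), of "(norm (op_adj a))\<^sup>2"]])
    show "norm ((norm (\<xi>' n))\<^sup>2) \<le> (norm (op_adj a))\<^sup>2 * (norm (\<xi> n))\<^sup>2" for n
      using power_mono[OF norm_blinfun, of "op_adj a" "\<xi> n" 2]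
      by (simp add: \<xi>'_def power_mult_distrib)
  qed
  moreover have "\<rho> (a o\<^sub>L x) = (\<Sum>n. cinner (\<xi>' n) (blinfun_apply x (\<eta> n)))" if "x \<in> M" for x
    using a that by (simp add: * compose \<xi>'_def cinner_op_adj_left bops)
  ultimately show ?thesis
    using *(2) by (auto simp: predual_def)
qed

text \<open>On bounded sets weak operator convergence implies ultraweak convergence: the series is
  dominated by R times a summable sequence, so limit and sum may be exchanged.\<close>

lemma predual_tendsto:
  assumes F: "F \<noteq> bot" and M: "\<And>n. x n \<in> M" "y \<in> M" and bound: "\<And>n. norm (x n) \<le> R"
    and lim: "\<And>\<xi> \<eta>. ((\<lambda>n. cinner \<xi> (blinfun_apply (x n) \<eta>)) \<longlongrightarrow> cinner \<xi> (blinfun_apply y \<eta>)) F"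
  shows "((\<lambda>n. \<rho> (x n)) \<longlongrightarrow> \<rho> y) F"
proof (rule predualE[OF \<rho>])
  fix \<xi> \<eta> :: "nat \<Rightarrow> 'h"
  assume *: "summable (\<lambda>n. norm (\<xi> n) * norm (\<eta> n))"
    "\<And>x. x \<in> M \<Longrightarrow> \<rho> x = (\<Sum>n. cinner (\<xi> n) (blinfun_apply x (\<eta> n)))"
  have "norm (cinner (\<xi> k) (blinfun_apply (x n) (\<eta> k))) \<le> R * (norm (\<xi> k) * norm (\<eta> k))" for k n
    by (rule order_trans[OF norm_cinner_apply_le mult_right_mono[OF bound]]) simp
  then have "((\<lambda>n. \<Sum>k. cinner (\<xi> k) (blinfun_apply (x n) (\<eta> k))) \<longlongrightarrow>
      (\<Sum>k. cinner (\<xi> k) (blinfun_apply y (\<eta> k)))) F"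
    using tannerys_theorem[of "\<lambda>k n. cinner (\<xi> k) (blinfun_apply (x n) (\<eta> k))"
        "\<lambda>k. cinner (\<xi> k) (blinfun_apply y (\<eta> k))" F "\<lambda>k. R * (norm (\<xi> k) * norm (\<eta> k))"]
      lim F summable_mult[OF *(1)] by (simp add: case_prod_unfold)
  then show ?thesis
    by (simp add: *(2) M)
qed

end

end

section \<open>Weak compactness of the unit ball\<close>

text \<open>Matrix coefficients place the sequence in a product of closed discs, which is compact by
  Tychonoff. The Hilbert space may be nonseparable, so a filter finer than
  \<open>sequentially\<close> takes the place of a subsequence; limits along
  \<open>sequentially\<close> remain valid along it.\<close>

lemma (in vn_algebra) weak_cluster_point:
  assumes x: "\<And>n. x n \<in> M" "\<And>n::nat. norm (x n) \<le> R"
  obtains y F where "y \<in> M" "norm y \<le> R" "F \<noteq> bot" "F \<le> sequentially"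
    "\<And>\<rho>. \<rho> \<in> predual M \<Longrightarrow> ((\<lambda>n. \<rho> (x n)) \<longlongrightarrow> \<rho> y) F"
proof -
  define v :: "nat \<Rightarrow> 'h \<times> 'h \<Rightarrow> complex"
    where "v n = (\<lambda>(\<xi>, \<eta>). cinner \<xi> (blinfun_apply (x n) \<eta>))" for n
  define K where "K = Pi\<^sub>E UNIV (\<lambda>(\<xi>, \<eta>::'h). cball 0 (R * norm (\<xi>::'h) * norm \<eta>) :: complex set)"
  have R: "R \<ge> 0" using x(2)[of 0] norm_ge_zero order_trans by blast
  have bound: "cmod (cinner \<xi> (blinfun_apply (x n) \<eta>)) \<le> R * norm \<xi> * norm \<eta>" for n \<xi> \<eta>
    using order_trans[OF norm_cinner_apply_le[of \<xi> "x n" \<eta>] mult_right_mono[OF x(2)[of n]]]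
    by (simp add: mult.assoc)
  have "compactin (product_topology (\<lambda>_. euclidean) UNIV) K"
    unfolding K_def by (auto simp: compactin_PiE compactin_euclidean_iff)
  then have "compact K"
    by (simp add: euclidean_product_topology)
  moreover have "v n \<in> K" for n
    using bound by (auto simp: K_def v_def PiE_UNIV_domain)
  then have "\<forall>\<^sub>F f in filtermap v sequentially. f \<in> K"
    by (simp add: eventually_filtermap)
  moreover have "filtermap v sequentially \<noteq> bot" by (simp add: filtermap_bot_iff)
  ultimately obtain L where L: "inf (nhds L) (filtermap v sequentially) \<noteq> bot"
    unfolding compact_filter by blast
  \<comment> \<open>The indices tending to infinity along which \<open>v n\<close> approaches
    \<open>L\<close>. This filter is proper precisely because \<open>L\<close> is a cluster
    point.\<close>
  define F where "F = inf (filtercomap v (nhds L)) sequentially"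
  have F: "F \<noteq> bot"
  proof
    assume "F = bot"
    then obtain P Q where P: "eventually P (nhds L)" and Q: "eventually Q sequentially"
      and PQ: "\<And>n. P (v n) \<Longrightarrow> Q n \<Longrightarrow> False"
      unfolding F_def trivial_limit_def eventually_inf eventually_filtercomap by metis
    have "eventually (\<lambda>f. \<exists>n. f = v n \<and> Q n) (filtermap v sequentially)"
      unfolding eventually_filtermap using Q by (rule eventually_mono) blast
    then have "eventually (\<lambda>_. False) (inf (nhds L) (filtermap v sequentially))"
      unfolding eventually_inf using P PQ by blast
    then show False using L by (simp add: trivial_limit_def)
  qed
  have "filterlim v (nhds L) F"
    unfolding F_def by (rule filterlim_mono[OF filterlim_filtercomap order_refl inf_le1])
  then have v_lim: "\<forall>\<^sub>F n in F. v n \<in> W" if "open W" "L \<in> W" for W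
    using that by (auto simp: filterlim_iff eventually_nhds)
  have "((\<lambda>n. v n p) \<longlongrightarrow> L p) F" for p
  proof (rule topological_tendstoI)
    fix S :: "complex set" assume "open S" "L p \<in> S"
    then have "open ((\<lambda>f. f p) -` S)"
      by (intro open_vimage continuous_on_product_coordinates)
    from v_lim[OF this] \<open>L p \<in> S\<close> show "\<forall>\<^sub>F n in F. v n p \<in> S" by simp
  qed
  then have lim: "((\<lambda>n. cinner \<xi> (blinfun_apply (x n) \<eta>)) \<longlongrightarrow> L (\<xi>, \<eta>)) F" for \<xi> \<eta>
    unfolding v_def by force
  note uniq = tendsto_unique[OF F]
  \<comment> \<open>Sesquilinearity and the bound hold for each coefficient function and pass to
    \<open>L\<close> by uniqueness of limits, so \<open>L\<close> comes from an operator.\<close>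
  have "\<exists>T\<in>bops. norm T \<le> R \<and> (\<forall>\<xi> \<eta>. L (\<xi>, \<eta>) = cinner \<xi> (blinfun_apply T \<eta>))"
  proof (rule sesquilinear_operator)
    show "R \<ge> 0" by (rule R)
  next
    fix \<xi> \<xi>' \<eta> and c
    show "L (\<xi> + \<xi>', \<eta>) = L (\<xi>, \<eta>) + L (\<xi>', \<eta>)"
      by (rule uniq[OF lim]) (use tendsto_add[OF lim lim] in \<open>simp add: cinner_add_left\<close>)
    show "L (\<eta>, \<xi> + \<xi>') = L (\<eta>, \<xi>) + L (\<eta>, \<xi>')"
      by (rule uniq[OF lim])
        (use tendsto_add[OF lim lim] in \<open>simp add: cinner_add_right blinfun.add_right\<close>)
    show "L (c *\<^sub>C \<xi>, \<eta>) = cnj c * L (\<xi>, \<eta>)"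
      by (rule uniq[OF lim]) (use tendsto_mult_left[OF lim] in \<open>simp add: cinner_scaleC_left\<close>)
    show "L (\<eta>, c *\<^sub>C \<xi>) = c * L (\<eta>, \<xi>)"
      by (rule uniq[OF lim])
        (use tendsto_mult_left[OF lim] in \<open>simp add: cinner_scaleC_right bopsD bops x\<close>)
    show "cmod (L (\<xi>, \<eta>)) \<le> R * norm \<xi> * norm \<eta>"
      by (rule tendsto_upperbound[OF tendsto_norm[OF lim] _ F]) (simp add: bound)
  qed
  then obtain T where T: "T \<in> bops" "norm T \<le> R"
    and LT: "\<And>\<xi> \<eta>. L (\<xi>, \<eta>) = cinner \<xi> (blinfun_apply T \<eta>)" by blast
  have "T \<in> M"
  proof (rule memI[OF T(1)])
    fix A assume A: "A \<in> commutant M"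
    have "cinner \<xi> (blinfun_apply T (blinfun_apply A \<eta>)) = cinner \<xi> (blinfun_apply A (blinfun_apply T \<eta>))" for \<xi> \<eta>
    proof (rule uniq[OF lim[unfolded LT]])
      have "blinfun_apply (x n) (blinfun_apply A \<eta>) = blinfun_apply A (blinfun_apply (x n) \<eta>)" for n
        using commutantD(2)[OF A x(1), of n] by (metis blinfun_apply_blinfun_compose)
      then show "((\<lambda>n. cinner \<xi> (blinfun_apply (x n) (blinfun_apply A \<eta>))) \<longlongrightarrow>
          cinner \<xi> (blinfun_apply A (blinfun_apply T \<eta>))) F"
        \<comment> \<open>With \<open>A\<close> moved to the left as its adjoint, the expression is
          again a matrix coefficient of \<open>x n\<close>.\<close>
        using lim[of "blinfun_apply (op_adj A) \<xi>" \<eta>]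
        by (simp add: cinner_op_adj_left commutantD(1)[OF A] LT)
    qed
    then show "T o\<^sub>L A = A o\<^sub>L T"
      by (intro blinfun_eqI cinner_eqI) simp
  qed
  show ?thesis
  proof (rule that[OF \<open>T \<in> M\<close> T(2) F])
    show "F \<le> sequentially" by (simp add: F_def)
    show "((\<lambda>n. \<rho> (x n)) \<longlongrightarrow> \<rho> T) F" if "\<rho> \<in> predual M" for \<rho>
      by (rule predual_tendsto[OF that F x(1) \<open>T \<in> M\<close> x(2) lim[unfolded LT]])
  qed
qed

section \<open>Unitaries\<close>

lemma norm_compose_power_le:
  fixes b T :: "'a::real_normed_vector \<Rightarrow>\<^sub>L 'a"
  shows "norm (((\<lambda>T. b o\<^sub>L T) ^^ n) T) \<le> norm b ^ n * norm T"
proof (induction n)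
  case (Suc n)
  have "norm (b o\<^sub>L ((\<lambda>T. b o\<^sub>L T) ^^ n) T) \<le> norm b * norm (((\<lambda>T. b o\<^sub>L T) ^^ n) T)"
    by (rule norm_blinfun_compose)
  also have "\<dots> \<le> norm b * (norm b ^ n * norm T)"
    by (intro mult_left_mono Suc) auto
  finally show ?case by (simp add: mult.assoc)
qed simp

text \<open>Neumann series: \<open>p n\<close> is the n-th power of \<open>b\<close>,
  \<open>r\<close> is the sum of all powers, and multiplying by \<open>b\<close> on either side
  drops the term of index 0.\<close>

lemma one_minus_invertible:
  fixes b :: "'a::banach \<Rightarrow>\<^sub>L 'a"
  assumes b: "norm b < 1"
  shows "\<exists>r. r o\<^sub>L (id_blinfun - b) = id_blinfun \<and> (id_blinfun - b) o\<^sub>L r = id_blinfun"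
proof -
  define p where "p n = ((\<lambda>T. b o\<^sub>L T) ^^ n) id_blinfun" for n
  define r where "r = (\<Sum>n. p n)"
  have p: "p 0 = id_blinfun" "b o\<^sub>L p n = p (Suc n)" for n
    by (simp_all add: p_def)
  have pb: "p n o\<^sub>L b = p (Suc n)" for n
    by (induction n) (simp_all add: p_def compose_assoc)
  interpret bounded_bilinear "(o\<^sub>L) :: ('a \<Rightarrow>\<^sub>L 'a) \<Rightarrow> ('a \<Rightarrow>\<^sub>L 'a) \<Rightarrow> _"
    by (rule bounded_bilinear_blinfun_compose)
  have sum: "summable p"
  proof (rule summable_comparison_test'[of "\<lambda>n. norm b ^ n * norm (id_blinfun :: 'a \<Rightarrow>\<^sub>L 'a)"])
    show "summable (\<lambda>n. norm b ^ n * norm (id_blinfun :: 'a \<Rightarrow>\<^sub>L 'a))"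
      using b by (intro summable_mult2 summable_geometric) simp
  qed (simp add: p_def norm_compose_power_le)
  have tail: "(\<Sum>n. p (Suc n)) = r - id_blinfun"
    using suminf_split_head[OF sum] by (simp add: r_def p)
  have "b o\<^sub>L r = r - id_blinfun"
    using bounded_linear.suminf[OF bounded_linear_right sum, of b] tail by (simp add: r_def p)
  moreover have "r o\<^sub>L b = r - id_blinfun"
    using bounded_linear.suminf[OF bounded_linear_left sum, of b] tail by (simp add: r_def pb)
  ultimately show ?thesis
    by (intro exI[of _ r]) (simp add: diff_left diff_right)
qed

context vn_algebra
begin

text \<open>An inverse commutes with whatever \<open>s\<close> commutes with, so it lies in the
  double commutant. Complex linearity has to be derived because elements of the operator type are a
  priori only real-linear.\<close>

lemma inverse_in:
  assumes s: "s \<in> M" and rs: "r o\<^sub>L s = id_blinfun" "s o\<^sub>L r = id_blinfun"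
  shows "r \<in> M"
proof (rule memI)
  have "blinfun_apply r (blinfun_apply s x) = x" "blinfun_apply s (blinfun_apply r x) = x" for x
    using rs by (metis blinfun_apply_blinfun_compose id_blinfun.rep_eq)+
  then have "blinfun_apply r (c *\<^sub>C x) = c *\<^sub>C blinfun_apply r x" for c x
    by (metis bops bopsD s)
  then show "r \<in> bops" by (simp add: bops_def)
  fix A assume "A \<in> commutant M"
  then have "s o\<^sub>L A = A o\<^sub>L s" using s by (rule commutantD)
  then show "r o\<^sub>L A = A o\<^sub>L r"
    by (metis rs compose_assoc compose_id)
qed

text \<open>The unitary to test against is (1 + i a)(1 - i a)^(-1). The norm bound makes 1 - i a
  invertible by a Neumann series, and \<open>a\<close> can be recovered from the unitary by
  operations that preserve commuting with \<open>x\<close>.\<close>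

lemma commute_selfadjoint:
  assumes x: "x \<in> M" and unitaries: "\<And>u. u \<in> M \<Longrightarrow> unitary u \<Longrightarrow> x o\<^sub>L u = u o\<^sub>L x"
    and a: "a \<in> M" "op_adj a = a" "norm a < 1"
  shows "x o\<^sub>L a = a o\<^sub>L x"
proof -
  define b where "b = \<i> *\<^sub>O a"
  have "norm b < 1"
  proof -
    have "norm b \<le> norm a"
      by (rule norm_blinfun_bound) (simp_all add: b_def norm_scaleC norm_blinfun)
    then show ?thesis using a by simp
  qed
  then obtain r where r: "r o\<^sub>L (id_blinfun - b) = id_blinfun" "(id_blinfun - b) o\<^sub>L r = id_blinfun"
    using one_minus_invertible by blast
  define s where "s = id_blinfun - b"
  define s' where "s' = id_blinfun + b"
  have bM: "b \<in> M" by (simp add: b_def scale a)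
  have sM: "s \<in> M" "s' \<in> M" by (simp_all add: s_def s'_def bM id diff add)
  have rs: "r o\<^sub>L s = id_blinfun" "s o\<^sub>L r = id_blinfun" using r by (simp_all add: s_def)
  have rM: "r \<in> M" using inverse_in sM rs by blast
  have "op_adj b = - b"
    using op_scale_scale[of "-1" \<i> a] by (simp add: b_def op_adj_scale a bops op_scale_minus_one)
  then have s_adj: "op_adj s = s'" "op_adj s' = s"
    using op_adj_add[of id_blinfun b] op_adj_add[of id_blinfun "- b"] bM bops[OF bM] bops[OF minus[OF bM]]
      op_adj_adj[of b] by (auto simp: s_def s'_def bops_id op_adj_id)
  have r': "op_adj r o\<^sub>L s' = id_blinfun" "s' o\<^sub>L op_adj r = id_blinfun"
    using arg_cong[OF rs(2), of op_adj] arg_cong[OF rs(1), of op_adj]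
    by (simp_all add: op_adj_compose bops sM rM s_adj op_adj_id)
  have s'_eq: "s' = 2 *\<^sub>R id_blinfun - s"
    by (simp add: s_def s'_def scaleR_2)
  interpret bounded_bilinear "(o\<^sub>L) :: 'h op \<Rightarrow> 'h op \<Rightarrow> _"
    by (rule bounded_bilinear_blinfun_compose)
  have ss': "s o\<^sub>L s' = s' o\<^sub>L s" and rs': "r o\<^sub>L s' = s' o\<^sub>L r"
    by (simp_all add: s'_eq diff_left diff_right scaleR_left scaleR_right rs)
  define u where "u = s' o\<^sub>L r" \<comment> \<open>the Cayley transform of \<open>a\<close>\<close>
  have uM: "u \<in> M" by (simp add: u_def compose sM rM)
  have u_adj: "op_adj u = op_adj r o\<^sub>L s"
    by (simp add: u_def op_adj_compose bops sM rM s_adj)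
  have "unitary u"
    unfolding unitary_def
  proof (intro conjI)
    have "op_adj u o\<^sub>L u = op_adj r o\<^sub>L (s o\<^sub>L s') o\<^sub>L r"
      unfolding u_adj by (simp add: u_def compose_assoc)
    also have "\<dots> = (op_adj r o\<^sub>L s') o\<^sub>L (s o\<^sub>L r)"
      unfolding ss' by (simp add: compose_assoc)
    finally show "op_adj u o\<^sub>L u = id_blinfun" by (simp add: r' rs)
    have "u o\<^sub>L op_adj u = (r o\<^sub>L s') o\<^sub>L (op_adj r o\<^sub>L s)"
      unfolding u_adj rs' by (simp add: u_def)
    also have "\<dots> = r o\<^sub>L (s' o\<^sub>L op_adj r) o\<^sub>L s" by (simp add: compose_assoc)
    finally show "u o\<^sub>L op_adj u = id_blinfun" by (simp add: r' rs)
  qed (simp add: uM bops)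
  then have "x o\<^sub>L u = u o\<^sub>L x" using unitaries uM by blast
  \<comment> \<open>Since s' = 2 - s, the unitary is affine in the resolvent \<open>r\<close>;
    commuting with \<open>u\<close> thus means commuting with \<open>r\<close>, hence with its
    inverse \<open>s\<close>.\<close>
  moreover have "u = 2 *\<^sub>R r - id_blinfun"
    by (simp add: u_def s'_eq diff_left scaleR_left rs)
  ultimately have "x o\<^sub>L r = r o\<^sub>L x"
    by (simp add: diff_left diff_right scaleR_left scaleR_right)
  then have "s o\<^sub>L x = x o\<^sub>L s"
    by (metis rs compose_assoc compose_id)
  then have "x o\<^sub>L b = b o\<^sub>L x"
    by (simp add: s_def diff_left diff_right)
  then have "\<i> *\<^sub>O (x o\<^sub>L a) = \<i> *\<^sub>O (a o\<^sub>L x)"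
    by (simp add: b_def compose_scale_left compose_scale_right bops x)
  then show ?thesis
    by (metis op_scale_scale op_scale_one divide_self_if complex_i_not_zero left_inverse)
qed

text \<open>Rescaling by 1 / (norm a + 1) removes the norm bound, and 2 z = h - i k with
  \<open>h\<close> and \<open>k\<close> self-adjoint reaches arbitrary elements.\<close>

lemma commute_if_commute_unitaries:
  assumes x: "x \<in> M" and unitaries: "\<And>u. u \<in> M \<Longrightarrow> unitary u \<Longrightarrow> x o\<^sub>L u = u o\<^sub>L x"
    and z: "z \<in> M"
  shows "x o\<^sub>L z = z o\<^sub>L x"
proof -
  interpret bounded_bilinear "(o\<^sub>L) :: 'h op \<Rightarrow> 'h op \<Rightarrow> _"
    by (rule bounded_bilinear_blinfun_compose)
  have sa: "x o\<^sub>L a = a o\<^sub>L x" if a: "a \<in> M" "op_adj a = a" for a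
  proof -
    define t where "t = inverse (norm a + 1)"
    have t: "t > 0" by (simp add: t_def add_nonneg_pos)
    define a' where "a' = complex_of_real t *\<^sub>O a"
    have a'_eq: "a' = t *\<^sub>R a"
      by (rule blinfun_eqI) (simp add: a'_def scaleR_scaleC blinfun.scaleR_left)
    have "norm a' < 1"
      using t by (simp add: a'_eq) (simp add: t_def field_simps add_nonneg_pos)
    then have "x o\<^sub>L a' = a' o\<^sub>L x"
      using a by (intro commute_selfadjoint[OF x unitaries])
        (simp_all add: a'_def scale op_adj_scale bops)
    then show ?thesis using t by (simp add: a'_eq scaleR_left scaleR_right)
  qed
  define h where "h = z + op_adj z"
  define k where "k = \<i> *\<^sub>O (z + - op_adj z)"
  have "x o\<^sub>L h = h o\<^sub>L x"
    by (rule sa) (auto simp: h_def add adj z op_adj_add bops op_adj_adj add.commute)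
  moreover have "x o\<^sub>L k = k o\<^sub>L x"
  proof (rule sa)
    have "op_adj (z + - op_adj z) = - (z + - op_adj z)"
      using z adj[OF z] minus[OF adj[OF z]]
      by (simp only: op_adj_add bops op_adj_minus op_adj_adj) simp
    then show "op_adj k = k"
      using add[OF z minus[OF adj[OF z]]]
      by (simp only: k_def op_adj_scale bops op_scale_uminus complex_cnj_i) simp
  qed (unfold k_def, intro add adj z minus scale)
  moreover have "2 *\<^sub>R z = h + (- \<i>) *\<^sub>O k"
    by (simp add: h_def k_def op_scale_scale scaleR_2 del: add_uminus_conv_diff)
  ultimately have "x o\<^sub>L (2 *\<^sub>R z) = (2 *\<^sub>R z) o\<^sub>L x"
    by (simp only: compose_add_left compose_add_right compose_scale_left compose_scale_right bops x)
  then show ?thesis by (simp add: scaleR_left scaleR_right)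
qed

end

section \<open>Uniqueness of the trace\<close>

locale tracial_factor = vn_algebra M for M :: "'h::chilbert_space op set" +
  fixes \<tau> :: "'h op \<Rightarrow> complex"
  assumes factor: "factor M"
    and trace: "faithful_normal_tracial_state M \<tau>"
begin

lemma trace_predual: "\<tau> \<in> predual M"
  and trace_id: "\<tau> id_blinfun = 1"
  and trace_nonneg: "x \<in> M \<Longrightarrow> \<tau> (op_adj x o\<^sub>L x) \<in> \<real>\<^sub>\<ge>\<^sub>0"
  and trace_faithful: "x \<in> M \<Longrightarrow> \<tau> (op_adj x o\<^sub>L x) = 0 \<Longrightarrow> x = 0"
  and trace_commute: "x \<in> M \<Longrightarrow> y \<in> M \<Longrightarrow> \<tau> (x o\<^sub>L y) = \<tau> (y o\<^sub>L x)"
  using trace by (auto simp: faithful_normal_tracial_state_def)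

lemmas trace_add = predual_add[OF trace_predual]
  and trace_scale = predual_scale[OF trace_predual]

text \<open>The pre-Hilbert space of the GNS construction for the trace, set up so that
  Cauchy-Schwarz and the parallelogram law apply to the 2-norm.\<close>

definition L2 :: "'h op form_space"
  where "L2 = \<lparr>vecs = M, vadd = (+), vscale = (*\<^sub>O), vform = \<lambda>x y. \<tau> (op_adj x o\<^sub>L y)\<rparr>"

lemma L2_simps [simp]:
  "vecs L2 = M" "vadd L2 = (+)" "vscale L2 = (*\<^sub>O)" "vform L2 x y = \<tau> (op_adj x o\<^sub>L y)"
  "vdiff L2 x y = x - y"
  by (simp_all add: L2_def vdiff_def op_scale_minus_one)

sublocale L2: psd_space L2
  by unfold_locales
    (simp_all add: add scale op_adj_add op_adj_scale compose_add_left compose_add_right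
      compose_scale_left compose_scale_right trace_add trace_scale compose adj bops op_adj_bops
      trace_nonneg)

text \<open>The set \<open>C\<close> of elements of norm at most \<open>\<parallel>y\<parallel>\<close> on which all normal traces agree with their
  value at \<open>y\<close> is convex, weakly compact and invariant under unitary conjugation. Its element of
  least 2-norm is thus central, i.e. a scalar.\<close>

theorem normal_trace_unique:
  assumes \<psi>: "\<psi> \<in> predual M" and tr: "\<And>x z. x \<in> M \<Longrightarrow> z \<in> M \<Longrightarrow> \<psi> (x o\<^sub>L z) = \<psi> (z o\<^sub>L x)"
    and y: "y \<in> M"
  shows "\<psi> y = \<psi> id_blinfun * \<tau> y"
proof -
  \<comment> \<open>All normal traces are treated at once, so that the single scalar found below
    serves both \<psi> and \<tau>.\<close>
  define T where "T = {\<psi> \<in> predual M. \<forall>x\<in>M. \<forall>z\<in>M. \<psi> (x o\<^sub>L z) = \<psi> (z o\<^sub>L x)}"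
  define C where "C = {x \<in> M. norm x \<le> norm y \<and> (\<forall>\<psi>\<in>T. \<psi> x = \<psi> y)}"
  define m where "m = (INF x\<in>C. (L2.vnorm x)\<^sup>2)"
  have CM: "x \<in> M" if "x \<in> C" for x using that by (simp add: C_def)
  have m_le: "m \<le> (L2.vnorm x)\<^sup>2" if "x \<in> C" for x
    unfolding m_def using that by (intro cINF_lower) (auto intro!: bdd_belowI[of _ 0])
  obtain z where z: "\<And>n. z n \<in> C" "\<And>n. (L2.vnorm (z n))\<^sup>2 < m + inverse (real (Suc n))"
  proof -
    have "C \<noteq> {}" using y by (auto simp: C_def)
    from INF_sequence[OF this, of "\<lambda>x. (L2.vnorm x)\<^sup>2"] show ?thesis
      using that unfolding m_def by blast
  qed
  obtain x F where x: "x \<in> M" "norm x \<le> norm y" and F: "F \<noteq> bot" "F \<le> sequentially"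
    and lim: "\<And>\<rho>. \<rho> \<in> predual M \<Longrightarrow> ((\<lambda>n. \<rho> (z n)) \<longlongrightarrow> \<rho> x) F"
    by (rule weak_cluster_point[of z "norm y"]) (use z in \<open>auto simp: C_def\<close>)
  have "x \<in> C"
  proof -
    have "\<psi> x = \<psi> y" if "\<psi> \<in> T" for \<psi>
    proof (rule tendsto_unique[OF F(1) lim])
      show "\<psi> \<in> predual M" using that by (simp add: T_def)
      have "\<psi> (z n) = \<psi> y" for n using z(1)[of n] that by (simp add: C_def)
      then show "((\<lambda>n. \<psi> (z n)) \<longlongrightarrow> \<psi> y) F" by simp
    qed
    then show ?thesis using x by (simp add: C_def)
  qed
  \<comment> \<open>Weak lower semicontinuity of the 2-norm: pairing \<open>z n\<close> with
    \<open>x\<close> converges to the square of the norm of \<open>x\<close>, while Cauchy-Schwarz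
    bounds the pairings by the norm of \<open>x\<close> times a sequence tending to sqrt m.\<close>
  have x_min: "(L2.vnorm x)\<^sup>2 = m"
  proof (rule antisym)
    have "((\<lambda>n. cmod (\<tau> (op_adj x o\<^sub>L z n))) \<longlongrightarrow> cmod (\<tau> (op_adj x o\<^sub>L x))) F"
      by (intro tendsto_norm lim[OF predual_mult_left[OF trace_predual]] adj x)
    moreover have "((\<lambda>n. L2.vnorm x * sqrt (m + inverse (real (Suc n)))) \<longlongrightarrow> L2.vnorm x * sqrt m) F"
      by (intro tendsto_intros filterlim_mono[OF LIMSEQ_inverse_real_of_nat_add order_refl F(2)])
    moreover have "cmod (\<tau> (op_adj x o\<^sub>L z n)) \<le> L2.vnorm x * sqrt (m + inverse (real (Suc n)))" for n
    proof -
      have "L2.vnorm (z n) \<le> sqrt (m + inverse (real (Suc n)))"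
        using z(2)[of n] by (intro real_le_rsqrt) simp
      then show ?thesis
        using L2.Cauchy_Schwarz[of x "z n"] x(1) CM[OF z(1)] L2.vnorm_nonneg[of x]
        by (simp add: order_trans[OF _ mult_left_mono])
    qed
    ultimately have "cmod (\<tau> (op_adj x o\<^sub>L x)) \<le> L2.vnorm x * sqrt m"
      by (intro tendsto_le[OF F(1)]) auto
    then have "L2.vnorm x * L2.vnorm x \<le> L2.vnorm x * sqrt m"
      using L2.form_self[of x] x(1) by (simp add: norm_mult power2_eq_square)
    then have "L2.vnorm x \<le> sqrt m \<or> L2.vnorm x = 0"
      using L2.vnorm_nonneg[of x] x(1)
      by (cases "L2.vnorm x = 0") (simp_all add: mult_le_cancel_left)
    moreover have "m \<ge> 0"
      unfolding m_def using y by (intro cINF_greatest) (auto simp: C_def)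
    ultimately show "(L2.vnorm x)\<^sup>2 \<le> m"
      using L2.vnorm_nonneg[of x] x(1) by (auto intro: sqrt_ge_absD simp: real_le_rsqrt)
  qed (rule m_le[OF \<open>x \<in> C\<close>])
  have comm: "x o\<^sub>L u = u o\<^sub>L x" if u: "u \<in> M" "unitary u" for u
  proof -
    have uu: "op_adj u o\<^sub>L u = id_blinfun" "u o\<^sub>L op_adj u = id_blinfun"
      using u by (auto simp: unitary_def)
    \<comment> \<open>The conjugate of \<open>x\<close> by \<open>u\<close> is another minimizer in
      \<open>C\<close>. The midpoint of \<open>x\<close> and \<open>w\<close> also lies in
      \<open>C\<close>, so the parallelogram law forces x = w.\<close>
    define w where "w = u o\<^sub>L x o\<^sub>L op_adj u"
    have wM: "w \<in> M" by (simp add: w_def compose adj x u)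
    have conj: "\<psi> (u o\<^sub>L v o\<^sub>L op_adj u) = \<psi> v" if "\<psi> \<in> T" "v \<in> M" for \<psi> v
    proof -
      have "\<psi> ((u o\<^sub>L v) o\<^sub>L op_adj u) = \<psi> (op_adj u o\<^sub>L (u o\<^sub>L v))"
        using that u by (simp add: T_def compose adj)
      then show ?thesis by (simp add: uu flip: compose_assoc)
    qed
    have tauT: "\<tau> \<in> T" by (simp add: T_def trace_predual trace_commute)
    have w_le: "norm w \<le> norm y"
    proof -
      have "norm w \<le> norm (u o\<^sub>L x) * norm (op_adj u)"
        unfolding w_def by (rule norm_blinfun_compose)
      also have "\<dots> \<le> (1 * norm y) * 1"
      proof (intro mult_mono)
        show "norm (u o\<^sub>L x) \<le> 1 * norm y"
          by (rule order_trans[OF norm_blinfun_compose mult_mono[OF norm_unitary[OF u(2)] x(2)]]) auto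
        show "norm (op_adj u) \<le> 1"
          using norm_op_adj_le[OF bops[OF u(1)]] norm_unitary[OF u(2)] by linarith
      qed auto
      finally show ?thesis by simp
    qed
    have "\<psi> w = \<psi> y" if "\<psi> \<in> T" for \<psi>
      using conj[OF that x(1)] \<open>x \<in> C\<close> that by (simp add: C_def w_def)
    then have "w \<in> C"
      using w_le by (simp add: C_def wM)
    have "op_adj w o\<^sub>L w = u o\<^sub>L (op_adj x o\<^sub>L x) o\<^sub>L op_adj u"
    proof -
      have "op_adj w = u o\<^sub>L op_adj x o\<^sub>L op_adj u"
        by (simp add: w_def op_adj_compose bops u x compose adj op_adj_adj compose_assoc)
      then have "op_adj w o\<^sub>L w = u o\<^sub>L op_adj x o\<^sub>L (op_adj u o\<^sub>L u) o\<^sub>L x o\<^sub>L op_adj u"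
        unfolding w_def by (simp add: compose_assoc)
      then show ?thesis by (simp add: uu compose_assoc)
    qed
    then have w_norm: "(L2.vnorm w)\<^sup>2 = m"
      using conj[OF tauT, of "op_adj x o\<^sub>L x"] x by (simp add: L2.vnorm_def compose adj flip: x_min)
    have "norm (complex_of_real (1/2) *\<^sub>O (x + w)) \<le> norm y"
      using norm_triangle_ineq[of x w] x(2) w_le
      unfolding op_scale_of_real by simp
    moreover have "\<psi> (complex_of_real (1/2) *\<^sub>O (x + w)) = \<psi> y" if "\<psi> \<in> T" for \<psi>
    proof -
      have "\<psi> x = \<psi> y" "\<psi> w = \<psi> y"
        using \<open>x \<in> C\<close> \<open>w \<in> C\<close> that by (auto simp: C_def)
      then show ?thesis
        using that x(1) wM by (simp add: T_def add predual_scale predual_add)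
    qed
    ultimately have "complex_of_real (1/2) *\<^sub>O (x + w) \<in> C"
      by (simp add: C_def scale add x wM)
    from m_le[OF this] have "m \<le> (cmod (complex_of_real (1/2)) * L2.vnorm (x + w))\<^sup>2"
      using L2.vnorm_scale[of "x + w" "complex_of_real (1/2)"] x(1) wM
      by (simp only: add L2_simps)
    then have "4 * m \<le> (L2.vnorm (x + w))\<^sup>2"
      by (simp add: norm_divide power_divide)
    moreover have "(L2.vnorm (x - w))\<^sup>2 + (L2.vnorm (x + w))\<^sup>2 = 2 * m + 2 * m"
      using L2.parallelogram[of x w] x(1) wM x_min w_norm by simp
    ultimately have "(L2.vnorm (x - w))\<^sup>2 \<le> 0" by linarith
    then have "L2.vnorm (x - w) = 0" by simp
    then have "x - w = 0"
      using trace_faithful[of "x - w"] L2.form_self[of "x - w"] x(1) wM by (simp add: diff)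
    then have "x o\<^sub>L u = w o\<^sub>L u" by simp
    then show ?thesis by (simp add: w_def compose_assoc uu)
  qed
  have "x o\<^sub>L v = v o\<^sub>L x" if "v \<in> M" for v
    by (rule commute_if_commute_unitaries[OF x(1) comm that])
  then have "x \<in> M \<inter> commutant M"
    using x by (auto simp: commutant_def bops)
  then obtain c where c: "x = c *\<^sub>O id_blinfun"
    using factor by (auto simp: factor_def)
  \<comment> \<open>Every normal trace takes the same value at \<open>y\<close> and at
    \<open>x\<close> = c 1; for \<tau> this identifies \<open>c\<close> as \<tau> y.\<close>
  have "\<psi> y = c * \<psi> id_blinfun" if "\<psi> \<in> T" for \<psi>
    using \<open>x \<in> C\<close> that c predual_scale[of \<psi> id_blinfun c] by (auto simp: C_def T_def id)
  from this[of \<psi>] this[of \<tau>] show ?thesis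
    using \<psi> tr by (simp add: T_def trace_predual trace_commute trace_id)
qed

end

section \<open>Continuous multiplicative functions on the half-line\<close>

text \<open>Used for two purposes: to recover an exponent from the values of the exponential, and to
  differentiate the Gram forms at 0.\<close>

lemma exp_difference_quotient:
  "((\<lambda>t. (exp (c * complex_of_real t) - 1) / complex_of_real t) \<longlongrightarrow> c) (at_right 0)"
proof -
  have "((\<lambda>z. exp (c * z)) has_field_derivative c) (at 0)"
    by (auto intro!: derivative_eq_intros)
  then have "((\<lambda>z. (exp (c * z) - 1) / z) \<longlongrightarrow> c) (at 0)"
    by (simp add: has_field_derivative_iff)
  moreover have "filterlim complex_of_real (at 0) (at_right 0)"
    unfolding filterlim_at
    by (auto simp: eventually_at_filter intro!: tendsto_eq_intros)
  ultimately show ?thesis by (rule filterlim_compose)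
qed

text \<open>A single time t > 0 determines the exponent only modulo 2 pi i / t; the limit t -> 0
  removes the ambiguity.\<close>

lemma exp_rate_unique:
  assumes "\<And>t. t \<ge> 0 \<Longrightarrow> exp (c * complex_of_real t) = exp (d * complex_of_real t)"
  shows "c = d"
proof (rule tendsto_unique[OF _ exp_difference_quotient])
  show "((\<lambda>t. (exp (c * complex_of_real t) - 1) / complex_of_real t) \<longlongrightarrow> d) (at_right 0)"
    by (rule Lim_transform_eventually[OF exp_difference_quotient])
      (use assms in \<open>auto simp: eventually_at_filter\<close>)
qed simp

text \<open>Integrating \<open>f (s + t) = f s * f t\<close> over \<open>s\<close> shows that \<open>f\<close> is differentiable.\<close>

lemma multiplicative_imp_exp:
  fixes f :: "real \<Rightarrow> complex"
  assumes mult: "\<And>s t. s \<ge> 0 \<Longrightarrow> t \<ge> 0 \<Longrightarrow> f (s + t) = f s * f t"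
    and f0: "f 0 = 1" and cont: "continuous_on {0..} f"
  shows "\<exists>c. \<forall>t\<ge>0. f t = exp (c * complex_of_real t)"
proof -
  define F where "F t = integral {0..t} f" for t
  have cont': "continuous_on {a..b} f" if "a \<ge> 0" for a b
    using that by (intro continuous_on_subset[OF cont]) auto
  have F: "(F has_vector_derivative f t) (at t within {0..b})" if "t \<in> {0..b}" for t b
    unfolding F_def by (rule integral_has_vector_derivative[OF cont' that]) simp
  \<comment> \<open>Otherwise \<open>F\<close> would vanish on [0,1], but its derivative at 0 is f 0
    = 1.\<close>
  have "\<exists>d>0. F d \<noteq> 0"
  proof (rule ccontr)
    assume "\<not> ?thesis"
    then have "F t = 0" if "t \<in> {0..1}" for t
      using that by (cases "t = 0") (auto simp: F_def)
    then have "((\<lambda>_. 0) has_vector_derivative f 0) (at 0 within {0..1})"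
      by (intro has_vector_derivative_transform[OF _ _ F[of 0 1]]) auto
    then have "f 0 = 0"
      using vector_derivative_unique_within_closed_interval[of 0 1 0 "\<lambda>_. 0" "f 0" 0] by simp
    then show False using f0 by simp
  qed
  then obtain d where d: "d > 0" "F d \<noteq> 0" by blast
  \<comment> \<open>Differentiating f t * F d = F (t + d) - F t gives f' t * F d = f t * (f d - 1),
    and \<open>c\<close> is the resulting ratio.\<close>
  define c where "c = (f d - 1) / F d"
  have shift: "f t * F d = F (t + d) - F t" if "t \<ge> 0" for t
  proof -
    have "f t * F d = integral {0..d} (f \<circ> (\<lambda>s. s + t))"
      unfolding F_def integral_mult_right[symmetric]
      by (rule integral_cong) (use that in \<open>simp add: mult mult.commute\<close>)
    also have "\<dots> = integral {0 + t..d + t} f"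
      by (rule integral_shift) (use that in \<open>intro cont'; simp\<close>)
    also have "\<dots> = F (t + d) - F t"
      unfolding F_def
      using Henstock_Kurzweil_Integration.integral_combine[of 0 t "t + d" f] that d cont'[of 0 "t + d"]
      by (simp add: integrable_continuous_interval algebra_simps)
    finally show ?thesis .
  qed
  have deriv: "(f has_vector_derivative c * f t) (at t within {0..b})" if t: "t \<in> {0..b}" for t b
  proof -
    have "((\<lambda>s. F (s + d)) has_vector_derivative f (t + d)) (at t within {0..b})"
    proof -
      have "((F \<circ> (\<lambda>s. s + d)) has_vector_derivative 1 *\<^sub>R f (t + d)) (at t within {0..b})"
      proof (rule vector_diff_chain_within)
        show "((\<lambda>s. s + d) has_vector_derivative 1) (at t within {0..b})"
          by (auto intro!: derivative_eq_intros)
        show "(F has_vector_derivative f (t + d)) (at (t + d) within (\<lambda>s. s + d) ` {0..b})"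
          by (rule has_vector_derivative_within_subset[OF F[where b = "b + d"]]) (use t d in auto)
      qed
      then show ?thesis by (simp add: o_def)
    qed
    then have D: "((\<lambda>s. (F (s + d) - F s) * (1 / F d)) has_vector_derivative (f (t + d) - f t) * (1 / F d))
        (at t within {0..b})"
      by (intro has_vector_derivative_mult_left has_vector_derivative_diff F t)
    have eq: "(f (t + d) - f t) * (1 / F d) = c * f t"
      using t d by (simp add: mult c_def field_simps)
    show ?thesis
      by (rule has_vector_derivative_transform[OF t _ D[unfolded eq]]) (use d in \<open>simp flip: shift\<close>)
  qed
  have "f t = exp (c * complex_of_real t)" if t: "t \<ge> 0" for t
  proof -
    \<comment> \<open>The product of \<open>f\<close> with the inverse of the expected exponential
      has derivative zero, which gives uniqueness for the differential equation f' = c f.\<close>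
    define h where "h s = f s * exp (- c * complex_of_real s)" for s
    have "(h has_vector_derivative 0) (at s within {0..t})" if s: "s \<in> {0..t}" for s
    proof -
      have "((\<lambda>s. exp (- c * complex_of_real s)) has_vector_derivative
          - c * exp (- c * complex_of_real s)) (at s within {0..t})"
        by (rule has_vector_derivative_real_field) (auto intro!: derivative_eq_intros)
      from has_vector_derivative_mult[OF deriv[OF s] this] show ?thesis
        by (simp add: h_def[abs_def] algebra_simps)
    qed
    then obtain k where k: "\<And>s. s \<in> {0..t} \<Longrightarrow> h s = k"
      using has_vector_derivative_zero_constant[of "{0..t}" h] by auto
    have "h t = 1" using k[of 0] k[of t] t by (simp add: h_def f0)
    then have "f t * (exp (- c * complex_of_real t) * exp (c * complex_of_real t)) = exp (c * complex_of_real t)"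
      by (simp add: h_def flip: mult.assoc)
    then show ?thesis by (simp flip: exp_add)
  qed
  then show ?thesis by blast
qed

section \<open>Gauge cocycles\<close>

lemma c_star_eqI:
  assumes "\<And>t. t \<ge> 0 \<Longrightarrow> \<tau> (op_adj (U t) o\<^sub>L V t) = exp (c * complex_of_real t)"
  shows "c_star \<tau> U V = c"
  unfolding c_star_def
proof (rule the_equality)
  fix d assume d: "\<forall>t\<ge>0. \<tau> (op_adj (U t) o\<^sub>L V t) = exp (d * complex_of_real t)"
  show "d = c"
  proof (rule exp_rate_unique)
    fix t :: real assume "t \<ge> 0"
    then show "exp (d * complex_of_real t) = exp (c * complex_of_real t)"
      using assms[of t] d by simp
  qed
qed (use assms in blast)

locale E0_factor = tracial_factor M \<tau> for M :: "'h::chilbert_space op set" and \<tau> +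
  fixes \<alpha> :: "real \<Rightarrow> 'h op \<Rightarrow> 'h op"
  assumes E0: "E0_semigroup M \<alpha>"
begin

lemma \<alpha>_endo: "t \<ge> 0 \<Longrightarrow> normal_unital_star_endomorphism M (\<alpha> t)"
  and \<alpha>_0: "x \<in> M \<Longrightarrow> \<alpha> 0 x = x"
  using E0 by (auto simp: E0_semigroup_def)

lemma \<alpha>_in: "t \<ge> 0 \<Longrightarrow> x \<in> M \<Longrightarrow> \<alpha> t x \<in> M"
  and \<alpha>_scale: "t \<ge> 0 \<Longrightarrow> x \<in> M \<Longrightarrow> \<alpha> t (c *\<^sub>O x) = c *\<^sub>O \<alpha> t x"
  and \<alpha>_compose: "t \<ge> 0 \<Longrightarrow> x \<in> M \<Longrightarrow> y \<in> M \<Longrightarrow> \<alpha> t (x o\<^sub>L y) = \<alpha> t x o\<^sub>L \<alpha> t y"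
  and \<alpha>_adj: "t \<ge> 0 \<Longrightarrow> x \<in> M \<Longrightarrow> \<alpha> t (op_adj x) = op_adj (\<alpha> t x)"
  and \<alpha>_id: "t \<ge> 0 \<Longrightarrow> \<alpha> t id_blinfun = id_blinfun"
  and \<alpha>_normal: "t \<ge> 0 \<Longrightarrow> \<rho> \<in> predual M \<Longrightarrow> \<rho> \<circ> \<alpha> t \<in> predual M"
  using \<alpha>_endo[of t] by (auto simp: normal_unital_star_endomorphism_def)

text \<open>The functional \<open>y \<mapsto> \<tau> (x \<alpha>\<^sub>t(y))\<close> is again a normal trace.\<close>

lemma trace_relative_commutant:
  assumes t: "t \<ge> 0" and x: "x \<in> M" "x \<in> commutant (\<alpha> t ` M)" and y: "y \<in> M"
  shows "\<tau> (x o\<^sub>L \<alpha> t y) = \<tau> x * \<tau> y"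
proof -
  have comm: "x o\<^sub>L \<alpha> t z = \<alpha> t z o\<^sub>L x" if "z \<in> M" for z
    using x that by (auto simp: commutant_def)
  have "(\<lambda>z. \<tau> (x o\<^sub>L z)) \<circ> \<alpha> t \<in> predual M"
    by (intro \<alpha>_normal t predual_mult_left trace_predual x)
  then have "((\<lambda>z. \<tau> (x o\<^sub>L z)) \<circ> \<alpha> t) y = ((\<lambda>z. \<tau> (x o\<^sub>L z)) \<circ> \<alpha> t) id_blinfun * \<tau> y"
  proof (rule normal_trace_unique)
    fix v w assume vw: "v \<in> M" "w \<in> M"
    \<comment> \<open>Here \<open>x\<close> commutes with the image of \<open>v\<close>; after this
      exchange cyclicity of \<tau> moves that image to the far right.\<close>
    have "\<tau> (x o\<^sub>L (\<alpha> t v o\<^sub>L \<alpha> t w)) = \<tau> (\<alpha> t v o\<^sub>L (x o\<^sub>L \<alpha> t w))"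
      by (metis comm vw(1) compose_assoc)
    also have "\<dots> = \<tau> ((x o\<^sub>L \<alpha> t w) o\<^sub>L \<alpha> t v)"
      by (intro trace_commute compose \<alpha>_in t vw x)
    finally show "((\<lambda>z. \<tau> (x o\<^sub>L z)) \<circ> \<alpha> t) (v o\<^sub>L w) = ((\<lambda>z. \<tau> (x o\<^sub>L z)) \<circ> \<alpha> t) (w o\<^sub>L v)"
      by (simp add: \<alpha>_compose t vw compose_assoc)
  qed (rule y)
  then show ?thesis by (simp add: \<alpha>_id t)
qed

lemma gauge_cocycleD:
  assumes "gauge_cocycle M \<alpha> U"
  shows "t \<ge> 0 \<Longrightarrow> U t \<in> M" and "t \<ge> 0 \<Longrightarrow> unitary (U t)"
    and "t \<ge> 0 \<Longrightarrow> U t \<in> commutant (\<alpha> t ` M)"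
    and "continuous_on {0..} (\<lambda>t. blinfun_apply (U t) x)"
    and "s \<ge> 0 \<Longrightarrow> t \<ge> 0 \<Longrightarrow> U (s + t) = U s o\<^sub>L \<alpha> s (U t)"
    and "U \<in> extensional {0..}"
  using assms by (auto simp: gauge_cocycle_def cocycle_def PiE_iff)

text \<open>The cocycle identity at s = t = 0 makes \<open>U 0\<close> idempotent, and a unitary
  idempotent is the identity.\<close>

lemma gauge_cocycle_0:
  assumes U: "gauge_cocycle M \<alpha> U" shows "U 0 = id_blinfun"
proof -
  have *: "op_adj (U 0) o\<^sub>L U 0 = id_blinfun"
    using gauge_cocycleD(2)[OF U, of 0] by (simp add: unitary_def)
  have "U 0 o\<^sub>L U 0 = U 0"
    using gauge_cocycleD(5)[OF U, of 0 0] gauge_cocycleD(1)[OF U, of 0] by (simp add: \<alpha>_0)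
  then have "op_adj (U 0) o\<^sub>L U 0 o\<^sub>L U 0 = op_adj (U 0) o\<^sub>L U 0"
    by (simp add: compose_assoc)
  then show ?thesis by (simp add: *)
qed

text \<open>The image of \<open>M\<close> under \<alpha> t is closed under adjoints, hence so is its
  commutant.\<close>

lemma relative_commutant_adj_compose:
  assumes t: "t \<ge> 0" and x: "x \<in> M" "x \<in> commutant (\<alpha> t ` M)"
    and y: "y \<in> M" "y \<in> commutant (\<alpha> t ` M)"
  shows "op_adj x o\<^sub>L y \<in> commutant (\<alpha> t ` M)"
proof -
  have comm: "x o\<^sub>L \<alpha> t z = \<alpha> t z o\<^sub>L x" "y o\<^sub>L \<alpha> t z = \<alpha> t z o\<^sub>L y" if "z \<in> M" for z
    using x y that by (auto simp: commutant_def)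
  have adj_comm: "op_adj x o\<^sub>L \<alpha> t z = \<alpha> t z o\<^sub>L op_adj x" if "z \<in> M" for z
    using arg_cong[OF comm(1)[OF adj[OF that]], of op_adj] that
    by (simp add: op_adj_compose \<alpha>_adj \<alpha>_in t bops adj x op_adj_adj)
  have "op_adj x o\<^sub>L y o\<^sub>L \<alpha> t z = \<alpha> t z o\<^sub>L (op_adj x o\<^sub>L y)" if "z \<in> M" for z
    by (simp add: compose_assoc comm that) (simp add: adj_comm that flip: compose_assoc)
  then show ?thesis
    by (auto simp: commutant_def bops compose adj x y)
qed

text \<open>By the cocycle identity the product at time s + t is the element \<open>x\<close> of the
  relative commutant, placed between the images under \<alpha> s of the adjoint of U t and of V t.
  Cyclicity brings both images to the right of \<open>x\<close>, where they merge into one, and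
  \<open>trace_relative_commutant\<close> splits the trace.\<close>

lemma trace_gauge_add:
  assumes U: "gauge_cocycle M \<alpha> U" and V: "gauge_cocycle M \<alpha> V" and st: "s \<ge> 0" "t \<ge> 0"
  shows "\<tau> (op_adj (U (s + t)) o\<^sub>L V (s + t))
    = \<tau> (op_adj (U s) o\<^sub>L V s) * \<tau> (op_adj (U t) o\<^sub>L V t)"
proof -
  note M = gauge_cocycleD(1)[OF U] gauge_cocycleD(1)[OF V]
  define x where "x = op_adj (U s) o\<^sub>L V s"
  have x: "x \<in> M" "x \<in> commutant (\<alpha> s ` M)"
    unfolding x_def using gauge_cocycleD(3)[OF U st(1)] gauge_cocycleD(3)[OF V st(1)] M st
    by (auto intro: compose adj relative_commutant_adj_compose)
  have "op_adj (U (s + t)) o\<^sub>L V (s + t) = op_adj (\<alpha> s (U t)) o\<^sub>L (x o\<^sub>L \<alpha> s (V t))"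
    using M st by (simp add: x_def gauge_cocycleD(5)[OF U] gauge_cocycleD(5)[OF V]
        op_adj_compose bops \<alpha>_in compose_assoc)
  also have "\<tau> \<dots> = \<tau> ((x o\<^sub>L \<alpha> s (V t)) o\<^sub>L op_adj (\<alpha> s (U t)))"
    using M st by (intro trace_commute adj compose \<alpha>_in x) auto
  also have "\<dots> = \<tau> (x o\<^sub>L \<alpha> s (V t o\<^sub>L op_adj (U t)))"
    using M st by (simp add: compose_assoc \<alpha>_compose \<alpha>_adj adj)
  also have "\<dots> = \<tau> x * \<tau> (V t o\<^sub>L op_adj (U t))"
    using M st by (intro trace_relative_commutant x compose adj) auto
  also have "\<tau> (V t o\<^sub>L op_adj (U t)) = \<tau> (op_adj (U t) o\<^sub>L V t)"
    using M st by (intro trace_commute adj) auto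
  finally show ?thesis by (simp add: x_def)
qed

text \<open>Moving the adjoint across the inner product leaves only \<open>U\<close> and
  \<open>V\<close> applied to fixed vectors, where strong continuity applies directly. Unitarity
  bounds the terms uniformly in \<open>t\<close>, so the series converges uniformly.\<close>

lemma trace_gauge_continuous:
  assumes U: "gauge_cocycle M \<alpha> U" and V: "gauge_cocycle M \<alpha> V"
  shows "continuous_on {0..} (\<lambda>t. \<tau> (op_adj (U t) o\<^sub>L V t))"
proof (rule predualE[OF trace_predual])
  fix \<xi> \<eta> :: "nat \<Rightarrow> 'h"
  assume *: "summable (\<lambda>n. norm (\<xi> n) * norm (\<eta> n))"
    "\<And>x. x \<in> M \<Longrightarrow> \<tau> x = (\<Sum>n. cinner (\<xi> n) (blinfun_apply x (\<eta> n)))"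
  define g where "g n t = cinner (blinfun_apply (U t) (\<xi> n)) (blinfun_apply (V t) (\<eta> n))" for n t
  have "norm (g n t) \<le> norm (\<xi> n) * norm (\<eta> n)" if "t \<in> {0..}" for n t
  proof -
    have "norm (blinfun_apply W x) \<le> norm x" if "unitary W" for W :: "'h op" and x
      using order_trans[OF norm_blinfun mult_right_mono[OF norm_unitary[OF that]]] by simp
    then show ?thesis
      unfolding g_def using that gauge_cocycleD(2)[OF U, of t] gauge_cocycleD(2)[OF V, of t]
      by (intro order_trans[OF cinner_Cauchy_Schwarz] mult_mono) auto
  qed
  then have "uniform_limit {0..} (\<lambda>n t. \<Sum>i<n. g i t) (\<lambda>t. \<Sum>i. g i t) sequentially"
    by (rule Weierstrass_m_test[OF _ *(1)])
  then have "continuous_on {0..} (\<lambda>t. \<Sum>i. g i t)"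
    by (rule uniform_limit_theorem[rotated])
      (auto simp: g_def intro!: always_eventually continuous_on_sum cinner.continuous_on
        gauge_cocycleD(4)[OF U] gauge_cocycleD(4)[OF V])
  moreover have "\<tau> (op_adj (U t) o\<^sub>L V t) = (\<Sum>i. g i t)" if "t \<in> {0..}" for t
    using that gauge_cocycleD(1)[OF U, of t] gauge_cocycleD(1)[OF V, of t]
    by (simp add: *(2) compose adj g_def cinner_op_adj_right bops)
  ultimately show ?thesis
    by (metis (no_types, lifting) continuous_on_eq)
qed

lemma c_star:
  assumes U: "gauge_cocycle M \<alpha> U" and V: "gauge_cocycle M \<alpha> V" and t: "t \<ge> 0"
  shows "\<tau> (op_adj (U t) o\<^sub>L V t) = exp (c_star \<tau> U V * complex_of_real t)"
proof -
  have "\<exists>c. \<forall>t\<ge>0. \<tau> (op_adj (U t) o\<^sub>L V t) = exp (c * complex_of_real t)"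
    by (rule multiplicative_imp_exp)
      (auto simp: trace_gauge_add[OF U V] gauge_cocycle_0[OF U] gauge_cocycle_0[OF V]
        op_adj_id trace_id trace_gauge_continuous[OF U V])
  then obtain c where "\<And>t. t \<ge> 0 \<Longrightarrow> \<tau> (op_adj (U t) o\<^sub>L V t) = exp (c * complex_of_real t)"
    by blast
  then show ?thesis using c_star_eqI t by metis
qed

section \<open>The gauge form\<close>

definition gauge_form :: "((real \<Rightarrow> 'h op) \<Rightarrow> complex) form_space"
  where "gauge_form = gauge_form_space M \<tau> \<alpha>"

lemma gauge_form_vecs: "f \<in> vecs gauge_form \<longleftrightarrow> finite {U. f U \<noteq> 0} \<and> (\<forall>U. f U \<noteq> 0 \<longrightarrow> gauge_cocycle M \<alpha> U) \<and>
    (\<Sum>U | f U \<noteq> 0. f U) = 0"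
  by (auto simp: gauge_form_def gauge_form_space_def gauge_group_def)

lemma gauge_form_ops: "vadd gauge_form f g = (\<lambda>U. f U + g U)" "vscale gauge_form c f = (\<lambda>U. c * f U)"
  by (simp_all add: gauge_form_def gauge_form_space_def)

lemma sum_support:
  assumes "finite S" "{U. f U \<noteq> 0} \<subseteq> S" "\<And>U. f U = 0 \<Longrightarrow> h U = (0::complex)"
  shows "(\<Sum>U | f U \<noteq> 0. h U) = (\<Sum>U\<in>S. h U)"
  using assms by (intro sum.mono_neutral_left) auto

text \<open>Supports shrink under cancellation, so sums over them are not additive as they stand. A
  common finite set \<open>S\<close> containing all supports makes bilinearity plain.\<close>

lemma gauge_form_form:
  assumes "finite S" "{U. f U \<noteq> 0} \<subseteq> S" "{U. g U \<noteq> 0} \<subseteq> S"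
  shows "vform gauge_form f g = (\<Sum>U\<in>S. \<Sum>V\<in>S. c_star \<tau> U V * cnj (f U) * g V)"
proof -
  have "vform gauge_form f g = (\<Sum>U | f U \<noteq> 0. \<Sum>V | g V \<noteq> 0. c_star \<tau> U V * cnj (f U) * g V)"
    by (simp add: gauge_form_def gauge_form_space_def)
  also have "\<dots> = (\<Sum>U\<in>S. \<Sum>V | g V \<noteq> 0. c_star \<tau> U V * cnj (f U) * g V)"
    using assms by (intro sum_support) auto
  also have "\<dots> = (\<Sum>U\<in>S. \<Sum>V\<in>S. c_star \<tau> U V * cnj (f U) * g V)"
    using assms by (intro sum.cong refl sum_support) auto
  finally show ?thesis .
qed

text \<open>The form is the limit as \<open>t \<rightarrow> 0\<close> of the Gram matrices of \<open>U\<^sub>t\<close>, divided by \<open>t\<close>; since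
  \<open>f\<close> sums to zero, the entries can be decreased by one.\<close>

lemma gauge_form_form_nonneg:
  assumes f: "f \<in> vecs gauge_form"
  shows "vform gauge_form f f \<in> \<real>\<^sub>\<ge>\<^sub>0"
proof -
  define S where "S = {U. f U \<noteq> 0}"
  have S: "finite S" "\<And>U. U \<in> S \<Longrightarrow> gauge_cocycle M \<alpha> U" "(\<Sum>U\<in>S. f U) = 0"
    using f by (auto simp: gauge_form_vecs S_def)
  define D where "D t = (\<Sum>U\<in>S. \<Sum>V\<in>S.
    (exp (c_star \<tau> U V * complex_of_real t) - 1) / complex_of_real t * cnj (f U) * f V)" for t
  have "(D \<longlongrightarrow> (\<Sum>U\<in>S. \<Sum>V\<in>S. c_star \<tau> U V * cnj (f U) * f V)) (at_right 0)"
    unfolding D_def by (intro tendsto_intros exp_difference_quotient)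
  moreover have "(\<Sum>U\<in>S. \<Sum>V\<in>S. c_star \<tau> U V * cnj (f U) * f V) = vform gauge_form f f"
    using S(1) by (subst gauge_form_form) (auto simp: S_def)
  ultimately have lim: "(D \<longlongrightarrow> vform gauge_form f f) (at_right 0)" by simp
  have D: "D t \<in> \<real>\<^sub>\<ge>\<^sub>0" if t: "t > 0" for t
  proof -
    have M: "V t \<in> M" if "V \<in> S" for V using gauge_cocycleD(1)[OF S(2)[OF that]] t by simp
    \<comment> \<open>The Gram form evaluated at \<open>f\<close> is the squared 2-norm of this
      element, which is where positivity comes from.\<close>
    define W where "W = (\<Sum>V\<in>S. f V *\<^sub>O V t)"
    have WM: "W \<in> M" unfolding W_def by (intro sum scale M)
    have right: "\<tau> (op_adj y o\<^sub>L W) = (\<Sum>V\<in>S. f V * \<tau> (op_adj y o\<^sub>L V t))" if y: "y \<in> M" for y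
    proof -
      have "op_adj y o\<^sub>L W = (\<Sum>V\<in>S. f V *\<^sub>O (op_adj y o\<^sub>L V t))"
        unfolding W_def bounded_bilinear.sum_right[OF bounded_bilinear_blinfun_compose]
        by (simp add: compose_scale_right op_adj_bops bops y)
      then show ?thesis
        by (simp add: predual_sum[OF trace_predual] scale compose adj y M trace_scale)
    qed
    have herm: "\<tau> (op_adj z o\<^sub>L y) = cnj (\<tau> (op_adj y o\<^sub>L z))" if "y \<in> M" "z \<in> M" for y z
      using L2.form_commute[of y z] that by simp
    have "\<tau> (op_adj W o\<^sub>L W) = (\<Sum>V\<in>S. f V * cnj (\<tau> (op_adj (V t) o\<^sub>L W)))"
      using right[OF WM] herm[OF M WM] by simp
    also have "\<dots> = (\<Sum>V\<in>S. f V * cnj (\<Sum>U\<in>S. f U * \<tau> (op_adj (V t) o\<^sub>L U t)))"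
      using right[OF M] by simp
    also have "\<dots> = (\<Sum>V\<in>S. \<Sum>U\<in>S. cnj (f U) * f V * \<tau> (op_adj (U t) o\<^sub>L V t))"
      by (simp add: sum_distrib_left mult_ac flip: herm[OF M M])
    also have "\<dots> = (\<Sum>U\<in>S. \<Sum>V\<in>S. cnj (f U) * f V * exp (c_star \<tau> U V * complex_of_real t))"
      by (subst sum.swap) (simp add: c_star S(2) less_imp_le[OF t])
    also have "\<dots> = (\<Sum>U\<in>S. \<Sum>V\<in>S. cnj (f U) * f V * (exp (c_star \<tau> U V * complex_of_real t) - 1))"
    proof -
      have "(\<Sum>U\<in>S. \<Sum>V\<in>S. cnj (f U) * f V) = cnj (\<Sum>U\<in>S. f U) * (\<Sum>V\<in>S. f V)"
        by (simp add: sum_product)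
      then show ?thesis by (simp add: S(3) algebra_simps sum_subtractf)
    qed
    also have "\<dots> = of_real t * D t"
      using t by (simp add: D_def sum_distrib_left mult_ac)
    finally have "of_real t * D t \<in> \<real>\<^sub>\<ge>\<^sub>0"
      using trace_nonneg[OF WM] by simp
    then show ?thesis
      using t by (auto simp: complex_nonneg_Reals_iff zero_le_mult_iff)
  qed
  have "\<forall>\<^sub>F t in at_right 0. D t \<in> \<real>\<^sub>\<ge>\<^sub>0"
    using eventually_at_right_less[of 0] by (rule eventually_mono) (rule D)
  then show ?thesis
    by (rule Lim_in_closed_set[OF closed_nonneg_Reals_complex _ _ lim]) simp
qed

lemma psd_gauge_form: "psd_space gauge_form"
proof
  fix f g assume fg: "f \<in> vecs gauge_form" "g \<in> vecs gauge_form"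
  let ?S = "{U. f U \<noteq> 0} \<union> {U. g U \<noteq> 0}"
  have S: "finite ?S" using fg by (simp add: gauge_form_vecs)
  have supp: "{U. f U + g U \<noteq> 0} \<subseteq> ?S" by auto
  have "(\<Sum>U | f U + g U \<noteq> 0. f U + g U) = (\<Sum>U\<in>?S. f U + g U)"
    by (intro sum_support[OF S supp])
  also have "\<dots> = (\<Sum>U | f U \<noteq> 0. f U) + (\<Sum>U | g U \<noteq> 0. g U)"
    using sum_support[OF S, of f f] sum_support[OF S, of g g] by (simp add: sum.distrib)
  finally show "vadd gauge_form f g \<in> vecs gauge_form"
    using fg finite_subset[OF supp S] supp by (auto simp: gauge_form_vecs gauge_form_ops subset_iff)
next
  fix f c assume f: "f \<in> vecs gauge_form"
  show "vscale gauge_form c f \<in> vecs gauge_form"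
    using f by (cases "c = 0") (auto simp: gauge_form_vecs gauge_form_ops simp flip: sum_distrib_left)
next
  fix f g h assume fgh: "f \<in> vecs gauge_form" "g \<in> vecs gauge_form" "h \<in> vecs gauge_form"
  obtain S where S: "finite S" and supp: "{U. f U \<noteq> 0} \<subseteq> S" "{U. g U \<noteq> 0} \<subseteq> S" "{U. h U \<noteq> 0} \<subseteq> S"
    and supp_add: "{U. f U + g U \<noteq> 0} \<subseteq> S"
    by (rule that[of "{U. f U \<noteq> 0} \<union> {U. g U \<noteq> 0} \<union> {U. h U \<noteq> 0}"]) (use fgh in \<open>auto simp: gauge_form_vecs\<close>)
  note form = gauge_form_form[OF S]
  show "vform gauge_form (vadd gauge_form f g) h = vform gauge_form f h + vform gauge_form g h"
    unfolding gauge_form_ops form[OF supp_add supp(3)] form[OF supp(1,3)] form[OF supp(2,3)]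
    by (simp add: distrib_left distrib_right sum.distrib)
  show "vform gauge_form h (vadd gauge_form f g) = vform gauge_form h f + vform gauge_form h g"
    unfolding gauge_form_ops form[OF supp(3) supp_add] form[OF supp(3,1)] form[OF supp(3,2)]
    by (simp add: distrib_left sum.distrib)
next
  fix f h c assume fh: "f \<in> vecs gauge_form" "h \<in> vecs gauge_form"
  obtain S where S: "finite S" and supp: "{U. f U \<noteq> 0} \<subseteq> S" "{U. h U \<noteq> 0} \<subseteq> S"
    and supp_scale: "{U. c * f U \<noteq> 0} \<subseteq> S"
    by (rule that[of "{U. f U \<noteq> 0} \<union> {U. h U \<noteq> 0}"]) (use fh in \<open>auto simp: gauge_form_vecs\<close>)
  note form = gauge_form_form[OF S]
  show "vform gauge_form (vscale gauge_form c f) h = cnj c * vform gauge_form f h"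
    unfolding gauge_form_ops form[OF supp_scale supp(2)] form[OF supp]
    by (simp add: sum_distrib_left mult_ac)
  show "vform gauge_form h (vscale gauge_form c f) = c * vform gauge_form h f"
    unfolding gauge_form_ops form[OF supp(2) supp_scale] form[OF supp(2,1)]
    by (simp add: sum_distrib_left mult_ac)
next
  fix f assume "f \<in> vecs gauge_form"
  then show "vform gauge_form f f \<in> \<real>\<^sub>\<ge>\<^sub>0" by (rule gauge_form_form_nonneg)
qed

section \<open>Scalar cocycles\<close>

definition phase :: "real \<Rightarrow> real \<Rightarrow> 'h op"
  where "phase \<theta> = (\<lambda>t\<in>{0..}. exp (\<i> * complex_of_real (\<theta> * t)) *\<^sub>O id_blinfun)"

lemma trace_scale_id: "\<tau> (c *\<^sub>O id_blinfun) = c"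
  by (simp add: trace_scale id trace_id)

lemma gauge_cocycle_phase: "gauge_cocycle M \<alpha> (phase \<theta>)"
proof -
  have "phase \<theta> \<in> {0..} \<rightarrow>\<^sub>E {V \<in> M. unitary V}"
    by (auto simp: phase_def scale id unitary_scale_id)
  moreover have "continuous_on {0..} (\<lambda>t. blinfun_apply (phase \<theta> t) x)" for x
  proof -
    have "continuous_on {0..} (\<lambda>t. exp (\<i> * complex_of_real (\<theta> * t)) *\<^sub>C x)"
      by (intro bounded_linear.continuous_on[OF bounded_linear_scaleC_left] continuous_intros)
    then show ?thesis
      by (rule continuous_on_eq) (simp add: phase_def)
  qed
  moreover have "phase \<theta> s o\<^sub>L \<alpha> s (phase \<theta> t) = phase \<theta> (s + t)" if "s \<ge> 0" "t \<ge> 0" for s t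
    using that by (simp add: phase_def \<alpha>_scale \<alpha>_id id compose_scale_left op_scale_scale
        distrib_left exp_add)
  moreover have "phase \<theta> t \<in> M \<inter> commutant (\<alpha> t ` M)" if "t \<ge> 0" for t
    using that by (auto simp: phase_def scale id commutant_def bops_scale bops_id
        compose_scale_left compose_scale_right bops \<alpha>_in)
  ultimately show ?thesis
    by (simp add: gauge_cocycle_def cocycle_def)
qed

lemma c_star_phases:
  assumes U: "\<And>t. t \<ge> 0 \<Longrightarrow> U t = exp (\<i> * complex_of_real (\<theta> * t)) *\<^sub>O id_blinfun"
    and V: "\<And>t. t \<ge> 0 \<Longrightarrow> V t = exp (\<i> * complex_of_real (\<theta>' * t)) *\<^sub>O id_blinfun"
  shows "c_star \<tau> U V = \<i> * complex_of_real \<theta>' - \<i> * complex_of_real \<theta>"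
proof (rule c_star_eqI)
  fix t :: real assume t: "t \<ge> 0"
  have "op_adj (U t) o\<^sub>L V t
      = (cnj (exp (\<i> * complex_of_real (\<theta> * t))) * exp (\<i> * complex_of_real (\<theta>' * t))) *\<^sub>O id_blinfun"
    using t by (simp add: U V op_adj_scale bops_id op_adj_id compose_scale_left op_scale_scale)
  then show "\<tau> (op_adj (U t) o\<^sub>L V t)
      = exp ((\<i> * complex_of_real \<theta>' - \<i> * complex_of_real \<theta>) * complex_of_real t)"
    by (simp add: trace_scale_id exp_cnj algebra_simps flip: exp_add)
qed

text \<open>Gauge cocycles and phases are both extensional on [0,oo), so agreement for all t >= 0 is
  equality of functions.\<close>

lemma gauge_group_trivial_iff: "gauge_group_trivial M \<alpha> \<longleftrightarrow>
    (\<forall>U. gauge_cocycle M \<alpha> U \<longrightarrow> (\<exists>\<theta>. U = phase \<theta>))"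
proof -
  have "(\<forall>t\<ge>0. U t = exp (\<i> * complex_of_real (\<theta> * t)) *\<^sub>O id_blinfun) \<longleftrightarrow> U = phase \<theta>"
    if "gauge_cocycle M \<alpha> U" for U \<theta>
    using gauge_cocycleD(6)[OF that] by (auto simp: phase_def extensional_def fun_eq_iff)
  then show ?thesis
    by (auto simp: gauge_group_trivial_def gauge_group_def)
qed

lemma form_zero_if_trivial:
  assumes triv: "\<And>U. gauge_cocycle M \<alpha> U \<Longrightarrow> \<exists>\<theta>. U = phase \<theta>" and f: "f \<in> vecs gauge_form"
  shows "vform gauge_form f f = 0"
proof -
  define S where "S = {U. f U \<noteq> 0}"
  have S: "finite S" "(\<Sum>U\<in>S. f U) = 0" "\<And>U. U \<in> S \<Longrightarrow> \<exists>\<theta>. U = phase \<theta>"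
    using f triv by (auto simp: gauge_form_vecs S_def)
  then obtain \<theta> where \<theta>: "\<And>U. U \<in> S \<Longrightarrow> U = phase (\<theta> U)" by metis
  have U: "U t = exp (\<i> * complex_of_real (\<theta> U * t)) *\<^sub>O id_blinfun" if "U \<in> S" "t \<ge> 0" for U t
    using fun_cong[OF \<theta>[OF that(1)], of t] that(2) by (simp add: phase_def)
  have c: "c_star \<tau> U V = \<i> * complex_of_real (\<theta> V) - \<i> * complex_of_real (\<theta> U)" if "U \<in> S" "V \<in> S" for U V
    by (rule c_star_phases) (use U that in auto)
  have "vform gauge_form f f = (\<Sum>U\<in>S. \<Sum>V\<in>S. c_star \<tau> U V * cnj (f U) * f V)"
    by (rule gauge_form_form[OF S(1)]) (auto simp: S_def)
  also have "\<dots> = (\<Sum>U\<in>S. \<Sum>V\<in>S. cnj (f U) * (\<i> * complex_of_real (\<theta> V) * f V)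
      - (\<i> * complex_of_real (\<theta> U) * cnj (f U)) * f V)"
    by (simp add: c algebra_simps)
  \<comment> \<open>Each of the two products contains the sum of \<open>f\<close> or its conjugate
    as a factor.\<close>
  also have "\<dots> = cnj (\<Sum>U\<in>S. f U) * (\<Sum>V\<in>S. \<i> * complex_of_real (\<theta> V) * f V)
      - (\<Sum>U\<in>S. \<i> * complex_of_real (\<theta> U) * cnj (f U)) * (\<Sum>V\<in>S. f V)"
    by (simp add: sum_subtractf sum_product)
  finally show ?thesis by (simp add: S(2))
qed

text \<open>Degeneracy of the form at \<open>\<delta>\<^sub>U - \<delta>\<^sub>1\<close> makes \<open>\<bar>\<tau> (U\<^sub>t)\<bar> = 1\<close>, the equality case of the
  Cauchy--Schwarz inequality for \<open>U\<^sub>t\<close> and \<open>1\<close>.\<close>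

lemma trivial_if_form_zero:
  assumes zero: "\<And>f. f \<in> vecs gauge_form \<Longrightarrow> vform gauge_form f f = 0" and U: "gauge_cocycle M \<alpha> U"
  shows "\<exists>\<theta>. U = phase \<theta>"
\<comment> \<open>The test function below takes the values 1 at \<open>U\<close> and -1 at
  \<open>phase 0\<close>, so the two points must differ.\<close>
proof (cases "U = phase 0")
  case False
  let ?E = "phase 0"
  have E: "gauge_cocycle M \<alpha> ?E" by (rule gauge_cocycle_phase)
  have E_eq: "?E t = id_blinfun" if "t \<ge> 0" for t using that by (simp add: phase_def)
  note M = gauge_cocycleD(1)[OF U]
  have diag: "c_star \<tau> V V = 0" if "gauge_cocycle M \<alpha> V" for V
    by (rule c_star_eqI) (use gauge_cocycleD(2)[OF that] in \<open>simp add: unitary_def trace_id\<close>)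
  define c where "c = c_star \<tau> ?E U"
  have tau: "\<tau> (U t) = exp (c * complex_of_real t)" if "t \<ge> 0" for t
    using c_star[OF E U that] that by (simp add: E_eq op_adj_id c_def)
  have tau_adj: "\<tau> (op_adj (U t)) = cnj (\<tau> (U t))" if "t \<ge> 0" for t
    using L2.form_commute[of id_blinfun "U t"] M[OF that] by (simp add: id op_adj_id)
  have c_cnj: "c_star \<tau> U ?E = cnj c"
    by (rule c_star_eqI) (simp add: E_eq tau_adj tau exp_cnj)
  define f where "f V = (if V = U then 1 else if V = ?E then -1 else 0 :: complex)" for V
  have supp: "{V. f V \<noteq> 0} = {U, ?E}" by (auto simp: f_def)
  have f_vals: "f U = 1" "f ?E = -1" using False by (auto simp: f_def)
  have "f \<in> vecs gauge_form"
    unfolding gauge_form_vecs supp using False U E by (auto simp: f_vals f_def split: if_splits)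
  then have "vform gauge_form f f = 0" by (rule zero)
  \<comment> \<open>The diagonal rates are 0 because \<tau> is normalised; only the two mixed terms,
    with sign -1, remain.\<close>
  moreover have "vform gauge_form f f = - cnj c - c"
    using False by (subst gauge_form_form[of "{U, ?E}"])
      (auto simp: supp f_vals diag U E c_cnj c_def[symmetric])
  ultimately have "Re c = 0" by (simp add: complex_eq_iff)
  then obtain r where c_eq: "c = \<i> * complex_of_real r"
    by (intro that[of "Im c"]) (simp add: complex_eq_iff)
  have "U t = exp (\<i> * complex_of_real (r * t)) *\<^sub>O id_blinfun" if t: "t \<ge> 0" for t
  proof -
    define e where "e = exp (\<i> * complex_of_real (r * t))"
    have "cmod e = 1" by (simp add: e_def)
    then have e: "\<tau> (U t) = e" "cnj e * e = 1"
      using complex_norm_square[of e] by (simp_all add: tau[OF t] c_eq mult.assoc mult.commute[of "cnj e"])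
        (simp add: e_def)
    have vecs: "U t \<in> vecs L2" "e *\<^sub>O id_blinfun \<in> vecs L2"
      using M[OF t] by (simp_all add: scale id)
    \<comment> \<open>The squared 2-norm of U t - e 1 expands to 1 - 1 - 1 + 1. The expansion is
      done before the simplification rules for \<open>L2\<close> turn \<open>vdiff\<close> into
      subtraction and hide the bilinear structure.\<close>
    have "vform L2 (vdiff L2 (U t) (e *\<^sub>O id_blinfun)) (vdiff L2 (U t) (e *\<^sub>O id_blinfun)) = 0"
      using M[OF t] gauge_cocycleD(2)[OF U t] e
      by (simp only: L2.form_diff_left L2.form_diff_right L2.diff_closed vecs)
        (simp add: id op_adj_scale bops_id op_adj_id compose_scale_left compose_scale_right trace_scale
          scale trace_id tau_adj[OF t] unitary_def adj bops op_adj_bops mult.commute)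
    then have "U t - e *\<^sub>O id_blinfun = 0"
      using M[OF t] by (intro trace_faithful) (simp_all add: diff scale id)
    then show ?thesis by (simp add: e_def)
  qed
  then have "U = phase r"
    using gauge_cocycleD(6)[OF U] by (auto simp: phase_def extensional_def fun_eq_iff)
  then show ?thesis by blast
qed blast

lemma gauge_index_eq_0_iff:
  "gauge_index M \<tau> \<alpha> =o (czero :: nat rel) \<longleftrightarrow> gauge_group_trivial M \<alpha>"
  unfolding gauge_index_def gauge_hilbert_space_def gauge_form_def[symmetric]
    psd_space.hilbert_dim_completion_eq_0_iff[OF psd_gauge_form] gauge_group_trivial_iff
  using form_zero_if_trivial trivial_if_form_zero by blast

section \<open>The isomorphism with the additive reals\<close>

lemma phase_add: "phase (\<theta> + \<theta>') = (\<lambda>t\<in>{0..}. phase \<theta> t o\<^sub>L phase \<theta>' t)"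
  unfolding phase_def
  by (rule restrict_ext)
    (simp add: compose_scale_left op_scale_scale distrib_left distrib_right exp_add)

lemma inj_phase: "inj phase"
proof (rule injI)
  fix \<theta> \<theta>' assume eq: "phase \<theta> = phase \<theta>'"
  have "\<i> * complex_of_real \<theta> = \<i> * complex_of_real \<theta>'"
  proof (rule exp_rate_unique)
    fix t :: real assume "t \<ge> 0"
    then have "\<tau> (exp (\<i> * complex_of_real (\<theta> * t)) *\<^sub>O id_blinfun)
        = \<tau> (exp (\<i> * complex_of_real (\<theta>' * t)) *\<^sub>O id_blinfun)"
      using fun_cong[OF eq, of t] by (simp add: phase_def)
    then show "exp (\<i> * complex_of_real \<theta> * complex_of_real t)
        = exp (\<i> * complex_of_real \<theta>' * complex_of_real t)"
      by (simp add: trace_scale_id mult.assoc)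
  qed
  then show "\<theta> = \<theta>'" by simp
qed

text \<open>Triviality is surjectivity of \<open>phase\<close>. The isomorphism is constructed from
  the reals, where the group axioms are immediate, and then inverted.\<close>

lemma gauge_group_iso:
  assumes "gauge_group_trivial M \<alpha>"
  shows "gauge_group M \<alpha> \<cong> \<lparr>carrier = (UNIV :: real set), mult = (+), one = 0\<rparr>"
proof -
  let ?R = "\<lparr>carrier = (UNIV :: real set), mult = (+), one = 0\<rparr>"
  have R: "group ?R"
    by (rule groupI) (simp_all, metis add.left_inverse)
  have "phase \<in> iso ?R (gauge_group M \<alpha>)"
  proof (rule isoI)
    show "phase \<in> hom ?R (gauge_group M \<alpha>)"
      by (rule homI) (simp_all add: gauge_group_def gauge_cocycle_phase phase_add)
    have "range phase = Collect (gauge_cocycle M \<alpha>)"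
      using assms gauge_cocycle_phase unfolding gauge_group_trivial_iff by blast
    then show "bij_betw phase (carrier ?R) (carrier (gauge_group M \<alpha>))"
      by (simp add: bij_betw_def gauge_group_def inj_phase)
  qed
  then have "?R \<cong> gauge_group M \<alpha>" by (rule is_isoI)
  then show ?thesis by (rule group.iso_sym[OF R])
qed

end

theorem corollary6p10:
  fixes M :: "'h::chilbert_space op set"
    and \<tau> :: "'h op \<Rightarrow> complex"
    and \<alpha> :: "real \<Rightarrow> 'h op \<Rightarrow> 'h op"
  assumes "II1_factor M"
    and "faithful_normal_tracial_state M \<tau>"
    and "E0_semigroup M \<alpha>"
  shows "(gauge_index M \<tau> \<alpha> =o (czero :: nat rel) \<longleftrightarrow> gauge_group_trivial M \<alpha>) \<and>
    (gauge_group_trivial M \<alpha> \<longrightarrow>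
       gauge_group M \<alpha> \<cong> \<lparr>carrier = (UNIV :: real set), mult = (+), one = 0\<rparr>)"
proof -
  interpret E0_factor M \<tau> \<alpha>
    by unfold_locales (use assms in \<open>simp_all add: II1_factor_def factor_def\<close>)
  show ?thesis
    using gauge_index_eq_0_iff gauge_group_iso by blast
qed

end
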